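(* For every $n\in\mathbb N$ (positive integer) and every real $h>0$, the best constant $$c(h,n):=\sup_{g\in T_{2n-1}^\perp,\ g\neq 0}\frac{\|g*\chi_h\|}{\|g\|}$$ in the inequality $|(g*\chi_h)(x)|\le c(h,n)\,\|g\|$, $g\in T_{2n-1}^\perp$, equals $$c(h,n)=E_n(\widetilde\chi_h)_1 .$$
   Context: All functions are real-valued; $T=\mathbb R/\mathbb Z$, so functions on $T$ are 1-periodic functions on $\mathbb R$. $T_{2n-1}$ is the space of 1-periodic real trigonometric polynomials of degree $\le n-1$, i.e. functions $\sum_{j=0}^{n-1}a_j\cos(2\pi jx)+\sum_{j=1}^{n-1}b_j\sin(2\pi jx)$ with real coefficients. $T_{2n-1}^\perp$ is the space of all $g\in L_\infty(T)$ with $\int_{-1/2}^{1/2}g(t)\tau(t)\,dt=0$ for every $\tau\in T_{2n-1}$. $\|\cdot\|$ is the (essential) supremum norm. For $h>0$, $\chi_h$ is the characteristic function of the interval $(-h/2,h/2)$ multiplied by $1/h$, so that $\int_{-h/2}^{h/2}\chi_h=1$, and $(g*\chi_h)(x)=\int_{\mathbb R}g(t)\chi_h(x-t)\,dt=\frac1h\int_{x-h/2}^{x+h/2}g(t)\,dt$. $\widetilde\chi_h(x):=\sum_{j\in\mathbb Z}\chi_h(x+j)$ is the 1-periodization of $\chi_h$. For a 1-periodic integrable function $F$, $E_n(F)_1:=\inf_{\tau\in T_{2n-1}}\int_T|F(t)-\tau(t)|\,dt$. *)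

theory Defs
  imports "HOL-Analysis.Analysis" "HOL-Probability.Essential_Supremum"
begin

text \<open>Functions on the circle \<open>\<real>/\<int>\<close> are 1-periodic functions on the real line. Elements of
  \<open>L\<^sub>\<infinity>\<close> are represented by Lebesgue measurable functions; equality of classes is equality
  almost everywhere.\<close>

definition periodic1 :: "(real \<Rightarrow> real) \<Rightarrow> bool" where
  "periodic1 f \<longleftrightarrow> (\<forall>x. f (x + 1) = f x)"

text \<open>The essential supremum is taken over the whole line, which for 1-periodic functions is the
  same as over one period.\<close>

definition sup_norm :: "(real \<Rightarrow> real) \<Rightarrow> ereal" where
  "sup_norm f = esssup lebesgue (\<lambda>x. ereal \<bar>f x\<bar>)"

definition Linf_T :: "(real \<Rightarrow> real) set" where
  "Linf_T = {g. g \<in> borel_measurable lebesgue \<and> periodic1 g \<and> sup_norm g < \<infinity>}"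

text \<open>The space \<open>T\<^bsub>2n-1\<^esub>\<close>, indexed here by \<open>n\<close>.\<close>

definition trig_polys :: "nat \<Rightarrow> (real \<Rightarrow> real) set" where
  "trig_polys n =
     {\<lambda>x. (\<Sum>j<n. a j * cos (2 * pi * real j * x)) + (\<Sum>j=1..<n. b j * sin (2 * pi * real j * x))
       | a b :: nat \<Rightarrow> real. True}"

definition trig_perp :: "nat \<Rightarrow> (real \<Rightarrow> real) set" where
  "trig_perp n = {g \<in> Linf_T. \<forall>\<tau>\<in>trig_polys n. (LINT t:{-1/2..1/2}|lebesgue. g t * \<tau> t) = 0}"

definition chi :: "real \<Rightarrow> real \<Rightarrow> real" where
  "chi h x = (1 / h) * indicator {-h/2<..<h/2} x"

definition convol :: "(real \<Rightarrow> real) \<Rightarrow> (real \<Rightarrow> real) \<Rightarrow> real \<Rightarrow> real" (infixl "\<star>" 70) where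
  "(f \<star> k) x = (LINT t|lebesgue. f t * k (x - t))"

definition periodization :: "(real \<Rightarrow> real) \<Rightarrow> real \<Rightarrow> real" where
  "periodization k x = (\<Sum>\<^sub>\<infinity>j\<in>(UNIV :: int set). k (x + of_int j))"

definition best_approx_L1 :: "nat \<Rightarrow> (real \<Rightarrow> real) \<Rightarrow> real" where
  "best_approx_L1 n F = (INF \<tau>\<in>trig_polys n. LINT t:{-1/2..1/2}|lebesgue. \<bar>F t - \<tau> t\<bar>)"

text \<open>The supremum is formed in the extended reals, so no boundedness is presupposed.\<close>

definition best_const :: "real \<Rightarrow> nat \<Rightarrow> ereal" where
  "best_const h n =
     (SUP g\<in>{g \<in> trig_perp n. \<not> (AE x in lebesgue. g x = 0)}. sup_norm (g \<star> chi h) / sup_norm g)"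

end

theory Submission
  imports Defs
begin

text \<open>The theorem is the duality between best \<open>L\<^sub>1\<close>-approximation and bounded functions that are
  orthogonal to the approximating space, applied to the periodized kernel.

  For the upper bound (\<open>best_const_le\<close>), the convolution at a point \<open>x\<close> is the integral over one period of
  \<open>g\<close> against the reflected and translated periodization of \<open>chi h\<close>
  (\<open>convol_chi_eq\<close>). Orthogonality allows the subtraction of any trigonometric polynomial of the given
  degree from this kernel, and Hoelder's inequality bounds the rest by the norm of \<open>g\<close> times the
  \<open>L\<^sub>1\<close>-distance from the kernel to that polynomial (\<open>convol_chi_le\<close>).

  For the lower bound (\<open>best_const_ge\<close>), a nearly extremal \<open>g\<close> is needed. Classically it is the sign
  of the kernel minus its best approximant, but for a piecewise constant kernel this difference can
  vanish on a set of positive measure, where the sign carries no information. The proof therefore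
  minimises, up to a small tolerance, a smoothed \<open>L\<^sub>1\<close>-error with integrand \<open>sqrt (u\<^sup>2 + \<epsilon>\<^sup>2)\<close>. The derivative
  of this integrand at the residual is bounded by 1, nearly orthogonal to the polynomials, and nearly
  norming for the residual; a small correction makes the orthogonality exact (\<open>L1_duality\<close>,
  \<open>circle_L1_duality\<close>). The best constant is a supremum, so nearly extremal functions suffice. The
  convolution is continuous, so that its value at 0, the duality integral, is a lower bound
  for its essential supremum (\<open>sup_norm_ge_isCont\<close>).\<close>

section \<open>Approximate duality for L1-approximation\<close>

text \<open>\<open>smooth_abs \<epsilon>\<close> approximates the absolute value uniformly within \<open>\<epsilon>\<close>, and
  \<open>smooth_sgn \<epsilon>\<close> is its derivative. Unlike the sign function, the latter gives a variation that is
  controlled even where the residual vanishes on a set of positive measure, which does happen for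
  the piecewise constant kernel below.\<close>

definition smooth_abs :: "real \<Rightarrow> real \<Rightarrow> real" where
  "smooth_abs \<epsilon> u = sqrt (u\<^sup>2 + \<epsilon>\<^sup>2)"

definition smooth_sgn :: "real \<Rightarrow> real \<Rightarrow> real" where
  "smooth_sgn \<epsilon> u = u / smooth_abs \<epsilon> u"

lemma smooth_abs_ge: "\<bar>u\<bar> \<le> smooth_abs \<epsilon> u"
  by (simp add: smooth_abs_def real_le_rsqrt)

lemma smooth_abs_le: "\<epsilon> > 0 \<Longrightarrow> smooth_abs \<epsilon> u \<le> \<bar>u\<bar> + \<epsilon>"
  using sqrt_add_le_add_sqrt[of "u\<^sup>2" "\<epsilon>\<^sup>2"] by (simp add: smooth_abs_def)

lemma smooth_abs_ge_eps: "\<epsilon> > 0 \<Longrightarrow> \<epsilon> \<le> smooth_abs \<epsilon> u"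
  by (simp add: smooth_abs_def real_le_rsqrt)

lemma smooth_abs_pos: "\<epsilon> > 0 \<Longrightarrow> 0 < smooth_abs \<epsilon> u"
  using smooth_abs_ge_eps[of \<epsilon> u] by linarith

lemma smooth_abs_sq: "(smooth_abs \<epsilon> u)\<^sup>2 = u\<^sup>2 + \<epsilon>\<^sup>2"
  by (simp add: smooth_abs_def)

lemma abs_smooth_sgn_le: "\<bar>smooth_sgn \<epsilon> u\<bar> \<le> 1"
  using smooth_abs_ge[of u \<epsilon>] by (auto simp: smooth_sgn_def divide_simps)

lemma smooth_sgn_mult_ge:
  assumes "\<epsilon> > 0"
  shows "smooth_abs \<epsilon> u - \<epsilon> \<le> smooth_sgn \<epsilon> u * u"
proof -
  have p: "smooth_abs \<epsilon> u > 0" by (rule smooth_abs_pos[OF assms])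
  have "(smooth_abs \<epsilon> u - \<epsilon>) * smooth_abs \<epsilon> u \<le> u\<^sup>2"
    using smooth_abs_ge_eps[OF assms, of u] smooth_abs_sq[of \<epsilon> u] assms
    by (simp add: algebra_simps power2_eq_square)
  then show ?thesis
    using p by (simp add: smooth_sgn_def field_simps power2_eq_square)
qed

text \<open>A first-order expansion whose quadratic remainder is uniform in \<open>u\<close>: with
  \<open>p = smooth_abs \<epsilon> u\<close> and \<open>q = smooth_abs \<epsilon> (u + v)\<close> it is \<open>2 p q \<le> p\<^sup>2 + q\<^sup>2\<close> divided by \<open>2 p\<close>,
  followed by \<open>p \<ge> \<epsilon>\<close>.\<close>

lemma smooth_abs_add_le:
  assumes "\<epsilon> > 0"
  shows "smooth_abs \<epsilon> (u + v) \<le> smooth_abs \<epsilon> u + smooth_sgn \<epsilon> u * v + v\<^sup>2 / (2 * \<epsilon>)"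
proof -
  let ?p = "smooth_abs \<epsilon> u" and ?q = "smooth_abs \<epsilon> (u + v)"
  have p: "?p > 0" "\<epsilon> \<le> ?p" using smooth_abs_pos smooth_abs_ge_eps assms by auto
  have "0 \<le> (?q - ?p)\<^sup>2" by simp
  then have "2 * ?p * ?q \<le> ?q\<^sup>2 + ?p\<^sup>2" by (simp add: power2_diff algebra_simps)
  also have "\<dots> = 2 * ?p\<^sup>2 + 2 * u * v + v\<^sup>2"
    unfolding smooth_abs_sq by (simp add: power2_sum algebra_simps)
  finally have "?q \<le> ?p + u / ?p * v + v\<^sup>2 / (2 * ?p)"
    using p by (simp add: field_simps power2_eq_square)
  also have "v\<^sup>2 / (2 * ?p) \<le> v\<^sup>2 / (2 * \<epsilon>)"
    using p assms by (intro divide_left_mono) auto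
  finally show ?thesis by (simp add: smooth_sgn_def)
qed

lemma borel_measurable_smooth [measurable]:
  "smooth_abs \<epsilon> \<in> borel_measurable borel" "smooth_sgn \<epsilon> \<in> borel_measurable borel"
  unfolding smooth_abs_def[abs_def] smooth_sgn_def[abs_def] by measurable

text \<open>A coefficient vector that nearly minimises the smoothed error is nearly critical: by the
  expansion \<open>smooth_abs_add_le\<close>, a large partial derivative in direction \<open>e i\<close> would allow a step
  that lowers the error by more than the tolerance. Working with near-minimisers avoids any
  compactness argument for the existence of a minimiser.\<close>

lemma (in finite_measure) near_critical_point:
  fixes e :: "'i \<Rightarrow> 'a \<Rightarrow> real" and F :: "'a \<Rightarrow> real"
  assumes I: "finite I"
    and e_meas: "\<And>i. i \<in> I \<Longrightarrow> e i \<in> borel_measurable M"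
    and e_le: "\<And>i x. i \<in> I \<Longrightarrow> \<bar>e i x\<bar> \<le> 1"
    and norm: "\<And>i. i \<in> I \<Longrightarrow> 0 < (LINT x|M. e i x * e i x)"
    and F: "integrable M F" and \<epsilon>: "\<epsilon> > 0" and \<eta>: "\<eta> > 0"
  obtains a where "\<And>i. i \<in> I \<Longrightarrow>
    \<bar>LINT x|M. smooth_sgn \<epsilon> (F x - (\<Sum>k\<in>I. a k * e k x)) * e i x\<bar> \<le> \<eta> * (LINT x|M. e i x * e i x)"
proof -
  define T where "T a x = (\<Sum>k\<in>I. a k * e k x)" for a x
  define \<Phi> where "\<Phi> a = (LINT x|M. smooth_abs \<epsilon> (F x - T a x))" for a
  define q where "q i = (LINT x|M. e i x * e i x)" for i
  obtain q0 where q0: "q0 > 0" "\<And>i. i \<in> I \<Longrightarrow> q0 \<le> q i"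
  proof
    show "Min (insert 1 (q ` I)) > 0" using norm I by (auto simp: q_def)
    show "Min (insert 1 (q ` I)) \<le> q i" if "i \<in> I" for i using that I by auto
  qed
  \<comment> \<open>The tolerance is chosen so that the decrease \<open>\<epsilon> * G\<^sup>2 / (2 * q i) \<le> \<delta>\<close> found below forces \<open>\<bar>G\<bar> \<le> \<eta> * q i\<close>.\<close>
  define \<delta> where "\<delta> = \<eta>\<^sup>2 * \<epsilon> * q0 / 2"
  have \<delta>: "\<delta> > 0" using q0 \<epsilon> \<eta> by (simp add: \<delta>_def)
  have [measurable]: "F \<in> borel_measurable M" using F by auto
  have int_e: "integrable M (e i)" if "i \<in> I" for i
    using that e_le e_meas by (intro integrable_const_bound[where B=1]) auto
  have int_ee: "integrable M (\<lambda>x. e i x * e i x)" if "i \<in> I" for i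
  proof (rule integrable_const_bound[where B=1])
    show "AE x in M. norm (e i x * e i x) \<le> 1"
      using e_le[OF that] by (intro AE_I2) (simp only: real_norm_def abs_mult mult_le_one abs_ge_zero)
    show "(\<lambda>x. e i x * e i x) \<in> borel_measurable M" using e_meas[OF that] by measurable
  qed
  have int_T: "integrable M (T a)" for a
    unfolding T_def[abs_def] using int_e by auto
  have int_u: "integrable M (\<lambda>x. F x - T a x)" for a using F int_T by auto
  have int_phi: "integrable M (\<lambda>x. smooth_abs \<epsilon> (F x - T a x))" for a
  proof (rule Bochner_Integration.integrable_bound)
    show "integrable M (\<lambda>x. \<bar>F x - T a x\<bar> + \<epsilon>)" using int_u[of a] by auto
    show "(\<lambda>x. smooth_abs \<epsilon> (F x - T a x)) \<in> borel_measurable M"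
      using borel_measurable_integrable[OF int_u[of a]] by measurable
    show "AE x in M. norm (smooth_abs \<epsilon> (F x - T a x)) \<le> norm (\<bar>F x - T a x\<bar> + \<epsilon>)"
      using smooth_abs_le[OF \<epsilon>] \<epsilon> smooth_abs_pos[OF \<epsilon>] by (auto simp: abs_of_pos)
  qed
  have \<Phi>_nonneg: "0 \<le> \<Phi> a" for a
    unfolding \<Phi>_def using smooth_abs_pos[OF \<epsilon>] by (intro Bochner_Integration.integral_nonneg) (auto intro: less_imp_le)
  have bdd: "bdd_below (range \<Phi>)" using \<Phi>_nonneg by (auto simp: bdd_below_def)
  obtain a where a: "\<Phi> a < (INF b. \<Phi> b) + \<delta>"
    using cINF_less_iff[of UNIV \<Phi> "(INF b. \<Phi> b) + \<delta>"] bdd \<delta> by auto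
  have near: "\<Phi> a \<le> \<Phi> b + \<delta>" for b
    using a cINF_lower[OF bdd, of b] by simp
  have "\<bar>LINT x|M. smooth_sgn \<epsilon> (F x - T a x) * e i x\<bar> \<le> \<eta> * q i" if i: "i \<in> I" for i
  proof -
    define G where "G = (LINT x|M. smooth_sgn \<epsilon> (F x - T a x) * e i x)"
    have int_G: "integrable M (\<lambda>x. smooth_sgn \<epsilon> (F x - T a x) * e i x)"
    proof (intro integrable_const_bound[where B=1])
      show "AE x in M. norm (smooth_sgn \<epsilon> (F x - T a x) * e i x) \<le> 1"
        using abs_smooth_sgn_le e_le[OF i] by (auto simp: abs_mult intro!: mult_le_one)
      show "(\<lambda>x. smooth_sgn \<epsilon> (F x - T a x) * e i x) \<in> borel_measurable M"
        using borel_measurable_integrable[OF int_u[of a]] e_meas[OF i] by measurable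
    qed
    \<comment> \<open>This step minimises the quadratic upper bound \<open>s * G + s\<^sup>2 * q i / (2 * \<epsilon>)\<close>.\<close>
    define s where "s = - \<epsilon> * G / q i"
    define b where "b = a(i := a i - s)"
    have qi: "q i > 0" "q0 \<le> q i" using norm[OF i] q0(2)[OF i] by (auto simp: q_def)
    have Tb: "F x - T b x = (F x - T a x) + s * e i x" for x
    proof -
      have "T b x = b i * e i x + (\<Sum>k\<in>I - {i}. b k * e k x)"
        unfolding T_def using I i by (simp add: sum.remove)
      also have "(\<Sum>k\<in>I - {i}. b k * e k x) = (\<Sum>k\<in>I - {i}. a k * e k x)"
        by (intro sum.cong) (auto simp: b_def)
      also have "b i * e i x + (\<Sum>k\<in>I - {i}. a k * e k x) = T a x - s * e i x"
        unfolding T_def using I i by (simp add: sum.remove b_def algebra_simps)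
      finally show ?thesis by simp
    qed
    have "\<Phi> b \<le> (LINT x|M. smooth_abs \<epsilon> (F x - T a x)
        + s * (smooth_sgn \<epsilon> (F x - T a x) * e i x) + s\<^sup>2 / (2 * \<epsilon>) * (e i x * e i x))"
      unfolding \<Phi>_def
    proof (intro Bochner_Integration.integral_mono int_phi)
      show "integrable M (\<lambda>x. smooth_abs \<epsilon> (F x - T a x)
        + s * (smooth_sgn \<epsilon> (F x - T a x) * e i x) + s\<^sup>2 / (2 * \<epsilon>) * (e i x * e i x))"
        using int_phi int_G int_ee[OF i] by auto
      show "smooth_abs \<epsilon> (F x - T b x) \<le> smooth_abs \<epsilon> (F x - T a x)
        + s * (smooth_sgn \<epsilon> (F x - T a x) * e i x) + s\<^sup>2 / (2 * \<epsilon>) * (e i x * e i x)" for x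
        using smooth_abs_add_le[OF \<epsilon>, of "F x - T a x" "s * e i x"]
        unfolding Tb by (simp add: algebra_simps power2_eq_square)
    qed
    also have "\<dots> = \<Phi> a + s * G + s\<^sup>2 / (2 * \<epsilon>) * q i"
      unfolding \<Phi>_def G_def q_def using int_phi int_G int_ee[OF i] by simp
    also have "\<dots> = \<Phi> a - \<epsilon> * G\<^sup>2 / (2 * q i)"
      using qi \<epsilon> by (simp add: s_def field_simps power2_eq_square)
    finally have "\<epsilon> * G\<^sup>2 / (2 * q i) \<le> \<delta>" using near[of b] by simp
    then have "G\<^sup>2 \<le> \<eta>\<^sup>2 * q0 * q i"
      using qi \<epsilon> by (simp add: \<delta>_def field_simps)
    also have "\<dots> \<le> \<eta>\<^sup>2 * q i * q i" using qi by (intro mult_right_mono mult_left_mono) auto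
    also have "\<dots> = (\<eta> * q i)\<^sup>2" by (simp add: power2_eq_square)
    finally show ?thesis unfolding G_def[symmetric] using qi \<eta> 
      by (auto simp flip: abs_le_square_iff)
  qed
  then show thesis using that[of a] by (simp add: T_def q_def)
qed

text \<open>The duality between \<open>L\<^sub>1\<close>-approximation from a finite orthogonal system and bounded functions that
  annihilate it, up to an arbitrarily small loss. At a near-critical point with residual \<open>u\<close>, the
  function \<open>smooth_sgn \<eta> \<circ> u\<close> is bounded by 1, almost orthogonal to the system, and its integral against
  \<open>u\<close> is almost the \<open>L\<^sub>1\<close>-norm of \<open>u\<close>. Subtracting its small orthogonal projection makes it exactly
  orthogonal, and division by \<open>1 + \<eta>\<close> restores the bound. After that, integrating against \<open>u\<close>
  and against \<open>F\<close> is the same. The clause on equal values says that \<open>g\<close> is a function of \<open>F\<close>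
  and the system only; on the circle it yields the periodicity of \<open>g\<close>.\<close>

lemma (in finite_measure) L1_duality:
  fixes e :: "'i \<Rightarrow> 'a \<Rightarrow> real" and F :: "'a \<Rightarrow> real"
  assumes I: "finite I"
    and e_meas: "\<And>i. i \<in> I \<Longrightarrow> e i \<in> borel_measurable M"
    and e_le: "\<And>i x. i \<in> I \<Longrightarrow> \<bar>e i x\<bar> \<le> 1"
    and orth: "\<And>i k. i \<in> I \<Longrightarrow> k \<in> I \<Longrightarrow> i \<noteq> k \<Longrightarrow> (LINT x|M. e i x * e k x) = 0"
    and norm: "\<And>i. i \<in> I \<Longrightarrow> 0 < (LINT x|M. e i x * e i x)"
    and F: "integrable M F" and \<epsilon>: "\<epsilon> > 0"
    and E0: "0 \<le> E" and E: "\<And>a. E \<le> (LINT x|M. \<bar>F x - (\<Sum>k\<in>I. a k * e k x)\<bar>)"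
  shows "\<exists>g\<in>borel_measurable M. (\<forall>x. \<bar>g x\<bar> \<le> 1) \<and> (\<forall>i\<in>I. (LINT x|M. g x * e i x) = 0) \<and>
    (\<forall>x y. F x = F y \<longrightarrow> (\<forall>i\<in>I. e i x = e i y) \<longrightarrow> g x = g y) \<and>
    E - \<epsilon> \<le> (LINT x|M. g x * F x)"
proof -
  define m where "m = measure M (space M)"
  \<comment> \<open>Orthogonalising and rescaling cost at most \<open>\<eta> * (2 * E + m)\<close> in total.\<close>
  define \<eta> where "\<eta> = min (1/2) (\<epsilon> / (2 * E + m + 1))"
  have m0: "m \<ge> 0" by (simp add: m_def)
  have "\<eta> > 0" using \<epsilon> m0 E0 by (simp add: \<eta>_def)
  moreover have "\<eta> \<le> 1/2" unfolding \<eta>_def by (rule min.cobounded1)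
  ultimately have \<eta>: "\<eta> > 0" "\<eta> \<le> 1/2" .
  have \<eta>_le: "\<eta> * (2 * E + m) \<le> \<epsilon>"
  proof -
    have "\<eta> * (2 * E + m) \<le> \<epsilon> / (2 * E + m + 1) * (2 * E + m)"
      using m0 E0 by (intro mult_right_mono) (auto simp: \<eta>_def)
    also have "\<dots> \<le> \<epsilon>" using m0 E0 \<epsilon> by (simp add: divide_simps)
    finally show ?thesis .
  qed
  \<comment> \<open>The summand 1 only keeps the divisor positive when \<open>I\<close> is empty.\<close>
  define N where "N = real (card I) + 1"
  have N: "N > 0" by (simp add: N_def)
  obtain a where a: "\<And>i. i \<in> I \<Longrightarrow>
      \<bar>LINT x|M. smooth_sgn \<eta> (F x - (\<Sum>k\<in>I. a k * e k x)) * e i x\<bar>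
        \<le> \<eta> / N * (LINT x|M. e i x * e i x)"
    using near_critical_point[of I e F \<eta> "\<eta> / N" thesis, OF I e_meas e_le norm F \<eta>(1)]
      divide_pos_pos[OF \<eta>(1) N] by blast
  define T where "T x = (\<Sum>k\<in>I. a k * e k x)" for x
  define u where "u x = F x - T x" for x
  define c where "c i = (LINT x|M. smooth_sgn \<eta> (u x) * e i x) / (LINT x|M. e i x * e i x)" for i
  define g1 where "g1 x = smooth_sgn \<eta> (u x) - (\<Sum>i\<in>I. c i * e i x)" for x
  have c_le: "\<bar>c i\<bar> \<le> \<eta> / N" if "i \<in> I" for i
    using a[OF that] norm[OF that] by (simp add: c_def u_def T_def abs_divide pos_divide_le_eq)
  have sum_c: "(\<Sum>i\<in>I. \<bar>c i\<bar>) \<le> \<eta>"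
  proof -
    have "(\<Sum>i\<in>I. \<bar>c i\<bar>) \<le> real (card I) * (\<eta> / N)"
      using c_le by (intro sum_bounded_above) auto
    also have "\<dots> \<le> \<eta>" using \<eta> N by (simp add: N_def field_simps)
    finally show ?thesis .
  qed
  have [measurable]: "F \<in> borel_measurable M" using F by auto
  have int_e: "integrable M (e i)" if "i \<in> I" for i
    using that e_le e_meas by (intro integrable_const_bound[where B=1]) auto
  have int_be: "integrable M (\<lambda>x. b x * e i x)"
    if "i \<in> I" "integrable M b" for i b
  proof (rule Bochner_Integration.integrable_bound[OF that(2)])
    show "AE x in M. norm (b x * e i x) \<le> norm (b x)"
      using e_le[OF that(1)] by (intro AE_I2) (simp add: abs_mult mult_left_le)
    show "(\<lambda>x. b x * e i x) \<in> borel_measurable M"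
      using e_meas[OF that(1)] that(2) by measurable
  qed
  have int_T: "integrable M T" unfolding T_def[abs_def] using int_e by auto
  have int_u: "integrable M u" unfolding u_def[abs_def] using F int_T by auto
  have u_meas [measurable]: "u \<in> borel_measurable M" using int_u by auto
  have ce_meas [measurable]: "(\<lambda>x. \<Sum>i\<in>I. c i * e i x) \<in> borel_measurable M"
    using e_meas by measurable
  have g1_meas [measurable]: "g1 \<in> borel_measurable M"
    unfolding g1_def[abs_def] by measurable
  have ce_le: "\<bar>\<Sum>i\<in>I. c i * e i x\<bar> \<le> \<eta>" for x
  proof -
    have "\<bar>\<Sum>i\<in>I. c i * e i x\<bar> \<le> (\<Sum>i\<in>I. \<bar>c i * e i x\<bar>)" by (rule sum_abs)
    also have "\<dots> \<le> (\<Sum>i\<in>I. \<bar>c i\<bar>)"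
      using e_le by (intro sum_mono) (simp add: abs_mult mult_left_le)
    finally show ?thesis using sum_c by simp
  qed
  have g1_le: "\<bar>g1 x\<bar> \<le> 1 + \<eta>" for x
    using abs_smooth_sgn_le[of \<eta> "u x"] ce_le[of x] by (simp add: g1_def)
  have int_sgn: "integrable M (\<lambda>x. smooth_sgn \<eta> (u x))"
    using abs_smooth_sgn_le by (intro integrable_const_bound[where B=1]) auto
  have int_g1: "integrable M g1"
    using g1_le by (intro integrable_const_bound[where B="1 + \<eta>"]) auto
  have g1_orth: "(LINT x|M. g1 x * e k x) = 0" if k: "k \<in> I" for k
  proof -
    have "(LINT x|M. g1 x * e k x)
        = (LINT x|M. smooth_sgn \<eta> (u x) * e k x - (\<Sum>i\<in>I. c i * (e i x * e k x)))"
      by (simp add: g1_def algebra_simps sum_distrib_left)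
    also have "\<dots> = (LINT x|M. smooth_sgn \<eta> (u x) * e k x) - (\<Sum>i\<in>I. c i * (LINT x|M. e i x * e k x))"
      using int_be[OF k int_sgn] int_be[OF k int_e] by simp
    also have "(\<Sum>i\<in>I. c i * (LINT x|M. e i x * e k x)) = c k * (LINT x|M. e k x * e k x)"
      using I k orth by (subst sum.remove[OF I k]) (auto intro!: sum.neutral)
    also have "\<dots> = (LINT x|M. smooth_sgn \<eta> (u x) * e k x)"
      using norm[OF k] by (simp add: c_def)
    finally show ?thesis by simp
  qed
  define A where "A = (LINT x|M. smooth_abs \<eta> (u x))"
  have int_abs: "integrable M (\<lambda>x. smooth_abs \<eta> (u x))"
  proof (rule Bochner_Integration.integrable_bound)
    show "integrable M (\<lambda>x. \<bar>u x\<bar> + \<eta>)" using int_u by auto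
    show "AE x in M. norm (smooth_abs \<eta> (u x)) \<le> norm (\<bar>u x\<bar> + \<eta>)"
      using smooth_abs_le[OF \<eta>(1)] \<eta> smooth_abs_pos[OF \<eta>(1)] by (auto simp: abs_of_pos)
  qed measurable
  have A_ge: "E \<le> A"
  proof -
    have "E \<le> (LINT x|M. \<bar>u x\<bar>)" using E[of a] by (simp add: u_def T_def)
    also have "\<dots> \<le> A" unfolding A_def
      using int_u int_abs smooth_abs_ge by (intro Bochner_Integration.integral_mono) auto
    finally show ?thesis .
  qed
  have int_g1F: "integrable M (\<lambda>x. g1 x * b x)" if b: "integrable M b" for b
  proof (rule Bochner_Integration.integrable_bound)
    show "integrable M (\<lambda>x. (1 + \<eta>) * b x)" using b by auto
    show "AE x in M. norm (g1 x * b x) \<le> norm ((1 + \<eta>) * b x)"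
      using g1_le \<eta> by (auto simp: abs_mult intro!: mult_right_mono)
    show "(\<lambda>x. g1 x * b x) \<in> borel_measurable M" using b by measurable
  qed
  have "(1 - \<eta>) * A - \<eta> * m = (LINT x|M. (smooth_abs \<eta> (u x) - \<eta>) - \<eta> * smooth_abs \<eta> (u x))"
    using int_abs by (simp add: A_def m_def algebra_simps)
  also have "\<dots> \<le> (LINT x|M. g1 x * u x)"
  proof (intro Bochner_Integration.integral_mono int_g1F int_u)
    show "integrable M (\<lambda>x. (smooth_abs \<eta> (u x) - \<eta>) - \<eta> * smooth_abs \<eta> (u x))"
      using int_abs by auto
    fix x
    have "(\<Sum>i\<in>I. c i * e i x) * u x \<le> \<bar>\<Sum>i\<in>I. c i * e i x\<bar> * \<bar>u x\<bar>"
      by (metis abs_ge_self abs_mult)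
    also have "\<dots> \<le> \<eta> * smooth_abs \<eta> (u x)"
      using ce_le[of x] smooth_abs_ge[of "u x" \<eta>] by (intro mult_mono) auto
    finally show "(smooth_abs \<eta> (u x) - \<eta>) - \<eta> * smooth_abs \<eta> (u x) \<le> g1 x * u x"
      using smooth_sgn_mult_ge[OF \<eta>(1), of "u x"] by (simp add: g1_def algebra_simps)
  qed
  also have "(LINT x|M. g1 x * u x) = (LINT x|M. g1 x * F x - (\<Sum>k\<in>I. a k * (g1 x * e k x)))"
    by (simp add: u_def T_def algebra_simps sum_distrib_left)
  also have "\<dots> = (LINT x|M. g1 x * F x)"
    using int_g1F[OF F] int_be[OF _ int_g1] g1_orth by simp
  finally have lower: "(1 - \<eta>) * A - \<eta> * m \<le> (LINT x|M. g1 x * F x)" .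
  let ?g = "\<lambda>x. g1 x / (1 + \<eta>)"
  show ?thesis
  proof (intro bexI[of _ ?g] conjI allI ballI impI)
    show "?g \<in> borel_measurable M" by measurable
    show "\<bar>?g x\<bar> \<le> 1" for x using g1_le[of x] \<eta> by (simp add: abs_divide)
    show "(LINT x|M. ?g x * e i x) = 0" if "i \<in> I" for i
      using g1_orth[OF that] by simp
    show "?g x = ?g y" if "F x = F y" "\<forall>i\<in>I. e i x = e i y" for x y
      using that by (simp add: g1_def u_def T_def)
    have "(E - \<epsilon>) * (1 + \<eta>) \<le> (E - \<eta> * (2 * E + m)) * (1 + \<eta>)"
      using \<eta>_le \<eta> by (intro mult_right_mono) auto
    also have "\<dots> = (1 - \<eta>) * E - \<eta> * m - \<eta> * (\<eta> * (2 * E + m))"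
      by (simp add: algebra_simps)
    also have "\<dots> \<le> (1 - \<eta>) * A - \<eta> * m"
    proof -
      have "(1 - \<eta>) * E \<le> (1 - \<eta>) * A" using A_ge \<eta> by (intro mult_left_mono) auto
      moreover have "0 \<le> \<eta> * (\<eta> * (2 * E + m))" using \<eta> E0 m0 by simp
      ultimately show ?thesis by simp
    qed
    finally show "E - \<epsilon> \<le> (LINT x|M. ?g x * F x)"
      using lower \<eta> by (simp add: pos_le_divide_eq)
  qed
qed

section \<open>Trigonometric polynomials on one period\<close>

lemma set_integrable_continuous_period:
  fixes f :: "real \<Rightarrow> real"
  assumes "continuous_on UNIV f"
  shows "set_integrable lebesgue {-1/2..1/2} f"
  using assms absolutely_integrable_continuous_real continuous_on_subset by blast

text \<open>The frequency is an integer and not a natural number because the product formulas used below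
  produce differences of frequencies.\<close>

lemma integral_cos_period:
  "(LINT x:{-1/2..1/2}|lebesgue. cos (2 * pi * of_int m * x)) = (if m = 0 then 1 else 0)"
proof (cases "m = 0")
  case True
  then show ?thesis by (simp add: set_lebesgue_integral_def)
next
  case False
  have "((\<lambda>x. cos (2 * pi * of_int m * x)) has_integral
      sin (2 * pi * of_int m * (1/2)) / (2 * pi * of_int m)
      - sin (2 * pi * of_int m * (-1/2)) / (2 * pi * of_int m)) {-1/2..1/2}"
    using False
    by (intro fundamental_theorem_of_calculus)
      (auto intro!: derivative_eq_intros simp flip: has_real_derivative_iff_has_vector_derivative)
  moreover have "sin (2 * pi * of_int m * (1/2)) = 0"
    by (simp add: sin_zero_iff_int2)
  ultimately have "((\<lambda>x. cos (2 * pi * of_int m * x)) has_integral 0) {-1/2..1/2}"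
    by simp
  moreover have "set_integrable lebesgue {-1/2..1/2} (\<lambda>x. cos (2 * pi * of_int m * x))"
    by (intro set_integrable_continuous_period continuous_intros)
  ultimately show ?thesis
    using False by (simp add: set_lebesgue_integral_eq_integral(2) integral_unique)
qed

lemma integral_sin_period:
  "(LINT x:{-1/2..1/2}|lebesgue. sin (2 * pi * of_int m * x)) = 0"
proof (cases "m = 0")
  case True
  then show ?thesis by (simp add: set_lebesgue_integral_def)
next
  case False
  have "((\<lambda>x. sin (2 * pi * of_int m * x)) has_integral
      (- cos (2 * pi * of_int m * (1/2)) / (2 * pi * of_int m))
      - (- cos (2 * pi * of_int m * (-1/2)) / (2 * pi * of_int m))) {-1/2..1/2}"
    using False
    by (intro fundamental_theorem_of_calculus)
      (auto intro!: derivative_eq_intros simp flip: has_real_derivative_iff_has_vector_derivative)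
  then have "((\<lambda>x. sin (2 * pi * of_int m * x)) has_integral 0) {-1/2..1/2}"
    by simp
  moreover have "set_integrable lebesgue {-1/2..1/2} (\<lambda>x. sin (2 * pi * of_int m * x))"
    by (intro set_integrable_continuous_period continuous_intros)
  ultimately show ?thesis
    using False by (simp add: set_lebesgue_integral_eq_integral(2) integral_unique)
qed

text \<open>A single family for cosines and sines lets the abstract duality lemma be applied.\<close>

fun trig_basis :: "nat + nat \<Rightarrow> real \<Rightarrow> real" where
  "trig_basis (Inl j) x = cos (2 * pi * real j * x)"
| "trig_basis (Inr j) x = sin (2 * pi * real j * x)"

definition trig_index :: "nat \<Rightarrow> (nat + nat) set" where
  "trig_index n = {..<n} <+> {1..<n}"

lemma finite_trig_index [simp]: "finite (trig_index n)"
  by (simp add: trig_index_def)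

lemma sum_trig_index:
  "(\<Sum>k\<in>trig_index n. a k * trig_basis k x) =
     (\<Sum>j<n. a (Inl j) * cos (2 * pi * real j * x)) + (\<Sum>j=1..<n. a (Inr j) * sin (2 * pi * real j * x))"
  unfolding trig_index_def by (simp add: sum.Plus)

lemma trig_polys_eq: "trig_polys n = range (\<lambda>a x. \<Sum>k\<in>trig_index n. a k * trig_basis k x)"
proof -
  have "\<exists>c. (\<lambda>x. (\<Sum>j<n. a j * cos (2 * pi * real j * x)) + (\<Sum>j=1..<n. b j * sin (2 * pi * real j * x)))
      = (\<lambda>x. \<Sum>k\<in>trig_index n. c k * trig_basis k x)" for a b
    by (intro exI[of _ "case_sum a b"]) (simp add: sum_trig_index)
  then show ?thesis
    unfolding trig_polys_def by (auto simp: sum_trig_index image_iff)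
qed

lemma abs_trig_basis_le: "\<bar>trig_basis k x\<bar> \<le> 1"
  by (cases k) auto

lemma continuous_trig_basis: "continuous_on S (trig_basis k)"
proof (cases k)
  case (Inl j) 
  then show ?thesis by (simp add: continuous_on_cong[OF refl, of _ "trig_basis k"]) (auto intro!: continuous_intros)
next
  case (Inr j) 
  then show ?thesis by (simp add: continuous_on_cong[OF refl, of _ "trig_basis k"]) (auto intro!: continuous_intros)
qed

lemma trig_basis_periodic: "trig_basis k (x + 1) = trig_basis k x"
proof -
  have shift: "2 * pi * real j * (x + 1) = 2 * pi * real j * x + 2 * real j * pi" for j
    by (simp add: algebra_simps)
  show ?thesis
  proof (cases k)
    case (Inl j)
    show ?thesis unfolding Inl trig_basis.simps shift cos_add cos_2npi sin_2npi by simp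
  next
    case (Inr j)
    show ?thesis unfolding Inr trig_basis.simps shift sin_add cos_2npi sin_2npi by simp
  qed
qed

text \<open>The function \<open>trig_basis (Inr 0)\<close> is identically zero and has to be left out, and the constant
  \<open>trig_basis (Inl 0)\<close> has a different norm from the others.\<close>

lemma integral_trig_basis_mult:
  assumes "k \<noteq> Inr 0" "l \<noteq> Inr 0"
  shows "(LINT x:{-1/2..1/2}|lebesgue. trig_basis k x * trig_basis l x)
    = (if k \<noteq> l then 0 else if k = Inl 0 then 1 else 1/2)"
proof -
  let ?I = "\<lambda>f. LINT x:{-1/2..1/2}|lebesgue. f x :: real"
  let ?c = "\<lambda>m x. cos (2 * pi * of_int m * x)" and ?s = "\<lambda>m x. sin (2 * pi * of_int m * x)"
  have C: "set_integrable lebesgue {-1/2..1/2} (?c m)" for m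
    by (intro set_integrable_continuous_period continuous_intros)
  have S: "set_integrable lebesgue {-1/2..1/2} (?s m)" for m
    by (intro set_integrable_continuous_period continuous_intros)
  have cc: "?I (\<lambda>x. trig_basis (Inl i) x * trig_basis (Inl j) x)
      = ((if i = j then 1 else 0) + (if i + j = 0 then 1 else 0)) / 2" for i j
  proof -
    have "trig_basis (Inl i) x * trig_basis (Inl j) x = (?c (int i - int j) x + ?c (int i + int j) x) / 2" for x
      by (simp add: cos_times_cos algebra_simps)
    then have "?I (\<lambda>x. trig_basis (Inl i) x * trig_basis (Inl j) x)
        = (?I (?c (int i - int j)) + ?I (?c (int i + int j))) / 2"
      using C by (simp only: set_integral_divide_zero set_integral_add(2))
    also have "\<dots> = ((if i = j then 1 else 0) + (if i + j = 0 then 1 else 0)) / 2"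
      unfolding integral_cos_period by auto
    finally show ?thesis .
  qed
  have ss: "?I (\<lambda>x. trig_basis (Inr i) x * trig_basis (Inr j) x)
      = ((if i = j then 1 else 0) - (if i + j = 0 then 1 else 0)) / 2" for i j
  proof -
    have "trig_basis (Inr i) x * trig_basis (Inr j) x = (?c (int i - int j) x - ?c (int i + int j) x) / 2" for x
      by (simp add: sin_times_sin algebra_simps)
    then have "?I (\<lambda>x. trig_basis (Inr i) x * trig_basis (Inr j) x)
        = (?I (?c (int i - int j)) - ?I (?c (int i + int j))) / 2"
      using C by (simp only: set_integral_divide_zero set_integral_diff(2))
    also have "\<dots> = ((if i = j then 1 else 0) - (if i + j = 0 then 1 else 0)) / 2"
      unfolding integral_cos_period by auto
    finally show ?thesis .
  qed
  have sc: "?I (\<lambda>x. trig_basis (Inr i) x * trig_basis (Inl j) x) = 0" for i j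
  proof -
    have "trig_basis (Inr i) x * trig_basis (Inl j) x = (?s (int i + int j) x + ?s (int i - int j) x) / 2" for x
      by (simp add: distrib_left distrib_right left_diff_distrib right_diff_distrib sin_add sin_diff)
    then have "?I (\<lambda>x. trig_basis (Inr i) x * trig_basis (Inl j) x)
        = (?I (?s (int i + int j)) + ?I (?s (int i - int j))) / 2"
      using S by (simp only: set_integral_divide_zero set_integral_add(2))
    then show ?thesis unfolding integral_sin_period by simp
  qed
  have cs: "?I (\<lambda>x. trig_basis (Inl j) x * trig_basis (Inr i) x) = 0" for i j
    using sc[of i j] by (simp only: mult.commute)
  show ?thesis
    using assms by (cases k; cases l) (simp_all only: cc ss sc cs, auto)
qed

text \<open>Since \<open>sin 0 = 0\<close>, the sine sum may start at 0; then the addition theorems act on each frequency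
  separately.\<close>

lemma trig_polys_eq_common_range:
  "trig_polys n = {\<lambda>x. \<Sum>j<n. a j * cos (2 * pi * real j * x) + b j * sin (2 * pi * real j * x)
     | a b :: nat \<Rightarrow> real. True}"
proof -
  have "(\<Sum>j=1..<n. b j * sin (2 * pi * real j * x)) = (\<Sum>j<n. b j * sin (2 * pi * real j * x))"
    for b :: "nat \<Rightarrow> real" and x
    by (intro sum.mono_neutral_left) (auto simp: Suc_le_eq)
  then show ?thesis
    unfolding trig_polys_def by (simp add: sum.distrib)
qed

lemma trig_polys_reflect:
  assumes "\<tau> \<in> trig_polys n"
  shows "(\<lambda>t. \<tau> (x - t)) \<in> trig_polys n"
proof -
  obtain a b where \<tau>: "\<tau> = (\<lambda>x. \<Sum>j<n. a j * cos (2 * pi * real j * x) + b j * sin (2 * pi * real j * x))"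
    using assms by (auto simp: trig_polys_eq_common_range)
  let ?w = "\<lambda>j. 2 * pi * real j"
  have "(\<lambda>t. \<tau> (x - t)) = (\<lambda>t. \<Sum>j<n. (a j * cos (?w j * x) + b j * sin (?w j * x)) * cos (?w j * t)
       + (a j * sin (?w j * x) - b j * cos (?w j * x)) * sin (?w j * t))"
    unfolding \<tau> right_diff_distrib cos_diff sin_diff
    by (intro ext sum.cong) (auto simp: algebra_simps)
  then show ?thesis
    unfolding trig_polys_eq_common_range
    by (intro CollectI exI[of _ "\<lambda>j. a j * cos (?w j * x) + b j * sin (?w j * x)"]
        exI[of _ "\<lambda>j. a j * sin (?w j * x) - b j * cos (?w j * x)"] conjI TrueI)
qed

lemma trig_polys_periodic: "\<tau> \<in> trig_polys n \<Longrightarrow> periodic1 \<tau>"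
  by (auto simp: trig_polys_eq periodic1_def trig_basis_periodic)

lemma continuous_trig_polys: "\<tau> \<in> trig_polys n \<Longrightarrow> continuous_on S \<tau>"
  by (auto simp: trig_polys_eq intro!: continuous_intros continuous_trig_basis)

lemma trig_polys_bounded:
  assumes "\<tau> \<in> trig_polys n"
  shows "\<exists>C. \<forall>x. \<bar>\<tau> x\<bar> \<le> C"
proof -
  obtain a where \<tau>: "\<tau> = (\<lambda>x. \<Sum>k\<in>trig_index n. a k * trig_basis k x)"
    using assms by (auto simp: trig_polys_eq)
  have "\<bar>\<tau> x\<bar> \<le> (\<Sum>k\<in>trig_index n. \<bar>a k\<bar>)" for x
    unfolding \<tau> using abs_trig_basis_le
    by (intro order_trans[OF sum_abs] sum_mono) (simp add: abs_mult mult_left_le)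
  then show ?thesis by blast
qed

section \<open>Periodization and integrals over a period\<close>

lemma periodic1_of_int:
  assumes "periodic1 f"
  shows "f (x + of_int j) = f x"
proof (induction j rule: int_induct[where k=0])
  case (step1 i)
  then show ?case using assms[unfolded periodic1_def, rule_format, of "x + of_int i"]
    by (simp add: add.assoc)
next
  case (step2 i)
  then show ?case using assms[unfolded periodic1_def, rule_format, of "x + of_int (i - 1)"]
    by simp
qed simp

lemma periodic1_periodization: "periodic1 (periodization f)"
  unfolding periodic1_def
proof
  fix x
  have "periodization f (x + 1) = (\<Sum>\<^sub>\<infinity>j\<in>(UNIV :: int set). f (x + of_int (j + 1)))"
    by (simp add: periodization_def add_ac)
  also have "\<dots> = periodization f x"
    unfolding periodization_def
    by (rule infsum_reindex_bij_betw[where g="\<lambda>j. j + 1" and f="\<lambda>j. f (x + of_int j)"])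
      (rule bij_plus_right)
  finally show "periodization f (x + 1) = periodization f x" .
qed

lemma periodization_reflect:
  "periodization (\<lambda>t. f (x - t)) t = periodization f (x - t)"
proof -
  have "periodization (\<lambda>t. f (x - t)) t = (\<Sum>\<^sub>\<infinity>j\<in>(UNIV :: int set). f (x - t + of_int (- j)))"
    by (simp add: periodization_def algebra_simps)
  also have "\<dots> = periodization f (x - t)"
    unfolding periodization_def
    by (rule infsum_reindex_bij_betw[where g="uminus" and f="\<lambda>j. f (x - t + of_int j)"])
      (rule bij_uminus)
  finally show ?thesis .
qed

lemma periodization_mult_periodic:
  assumes "periodic1 g"
  shows "periodization (\<lambda>t. g t * f t) t = g t * periodization f t"
  unfolding periodization_def periodic1_of_int[OF assms] by (rule infsum_cmult_right')

text \<open>Bounded support makes the periodization a finite sum, with one range of indices for all points of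
  a bounded interval.\<close>

lemma periodization_eq_sum:
  assumes "\<And>x. \<bar>x\<bar> > R \<Longrightarrow> f x = 0" and "R + \<bar>x\<bar> \<le> of_int N"
  shows "periodization f x = (\<Sum>j\<in>{-N..N}. f (x + of_int j))"
proof -
  have "periodization f x = infsum (\<lambda>j. f (x + of_int j)) {-N..N}"
    unfolding periodization_def
  proof (rule infsum_cong_neutral)
    fix j assume j: "j \<in> UNIV - {-N..N}"
    then have "of_int N < \<bar>of_int j :: real\<bar>"
      by (auto simp flip: of_int_abs)
    then show "f (x + of_int j) = 0" using assms(2) by (intro assms(1)) linarith
  qed auto
  then show ?thesis by simp
qed

lemma borel_measurable_periodization:
  assumes [measurable]: "f \<in> borel_measurable borel" and f0: "\<And>x. \<bar>x\<bar> > R \<Longrightarrow> f x = 0"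
  shows "periodization f \<in> borel_measurable borel"
proof (rule borel_measurable_LIMSEQ_real)
  show "(\<lambda>N. \<Sum>j\<in>{- int N..int N}. f (x + of_int j)) \<longlonglongrightarrow> periodization f x" for x
  proof (rule tendsto_eventually)
    have "\<forall>\<^sub>F N in sequentially. R + \<bar>x\<bar> \<le> real N"
      by (rule eventually_sequentiallyI[of "nat \<lceil>R + \<bar>x\<bar>\<rceil>"]) linarith
    then show "\<forall>\<^sub>F N in sequentially. (\<Sum>j\<in>{- int N..int N}. f (x + of_int j)) = periodization f x"
      by eventually_elim (rule periodization_eq_sum[OF f0, symmetric], auto)
  qed
  show "(\<lambda>x. \<Sum>j\<in>{- int N..int N}. f (x + of_int j)) \<in> borel_measurable borel" for N
    by measurable
qed

lemma periodization_bounded: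
  assumes f0: "\<And>x. \<bar>x\<bar> > R \<Longrightarrow> f x = 0" and le: "\<And>x. \<bar>f x\<bar> \<le> B"
  shows "\<exists>C. \<forall>x. \<bar>periodization f x\<bar> \<le> C"
proof -
  define N where "N = \<lceil>R + 1\<rceil>"
  have "\<bar>periodization f x\<bar> \<le> (\<Sum>j\<in>{-N..N}. B)" for x
  proof -
    define y where "y = x - of_int \<lfloor>x\<rfloor>"
    have y: "0 \<le> y" "y \<le> 1" unfolding y_def by linarith+
    have "periodization f x = periodization f y"
      using periodic1_of_int[OF periodic1_periodization, of f y "\<lfloor>x\<rfloor>"] by (simp add: y_def)
    also have "\<dots> = (\<Sum>j\<in>{-N..N}. f (y + of_int j))"
    proof (rule periodization_eq_sum[OF f0])
      show "R + \<bar>y\<bar> \<le> of_int N" unfolding N_def using y by linarith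
    qed
    finally show ?thesis by (simp only:) (intro order_trans[OF sum_abs] sum_mono le)
  qed
  then show ?thesis by blast
qed

text \<open>The closed periods \<open>[j - 1/2, j + 1/2]\<close> overlap in the half-integers, so they tile the line only
  up to this null set.\<close>

lemma AE_not_half_integer: "AE t in lebesgue. t - x + 1/2 \<notin> (\<int> :: real set)"
proof -
  have "countable ((\<lambda>z. z + x - 1/2) ` \<int> :: real set)"
    by (intro countable_image countable_int)
  then have "AE t in lebesgue. t \<notin> (\<lambda>z. z + x - 1/2) ` (\<int> :: real set)"
    by (intro AE_not_in null_sets_completionI countable_imp_null_set_lborel)
  then show ?thesis
    by eventually_elim (force simp: image_iff algebra_simps)
qed

lemma sum_translates_period:
  fixes t :: real
  assumes "t + 1/2 \<notin> \<int>" and "\<bar>t\<bar> + 1 \<le> of_int N"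
  shows "(\<Sum>j\<in>{-N..N}. indicator {-1/2..1/2} (t - of_int j)) = (1 :: real)"
proof -
  define k where "k = \<lfloor>t + 1/2\<rfloor>"
  have ne: "of_int k \<noteq> t + 1/2" using assms(1) by (metis Ints_of_int)
  have k: "of_int k < t + 1/2" "t + 1/2 < of_int k + 1"
    using ne unfolding k_def by linarith+
  have kN: "k \<in> {-N..N}"
    using k assms(2) by auto
  have "indicator {-1/2..1/2} (t - of_int j) = (if j = k then 1 else 0 :: real)" for j
  proof (cases "j = k")
    case False
    then have "j \<le> k - 1 \<or> j \<ge> k + 1" by linarith
    then have "of_int j \<le> (of_int k - 1 :: real) \<or> of_int j \<ge> (of_int k + 1 :: real)"
      by (metis of_int_1 of_int_add of_int_diff of_int_le_iff)
    then show ?thesis using False k by (auto simp: indicator_def)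
  qed (use k in \<open>auto simp: indicator_def\<close>)
  then show ?thesis using kN by simp
qed

text \<open>Cutting the line into translates of one period. This single identity gives both the circular
  form of a convolution and the invariance of integrals over a period.\<close>

lemma integral_periodization:
  assumes f: "integrable lebesgue f" and f0: "\<And>x. \<bar>x\<bar> > R \<Longrightarrow> f x = 0"
  shows "set_integrable lebesgue {-1/2..1/2} (periodization f)"
    and "(LINT t:{-1/2..1/2}|lebesgue. periodization f t) = (LINT t|lebesgue. f t)"
proof -
  define N where "N = \<lceil>R + 1\<rceil>"
  let ?i = "indicat_real {-1/2..1/2}"
  have eq: "?i t * periodization f t = (\<Sum>j\<in>{-N..N}. ?i t * f (t + of_int j))" for t
  proof (cases "t \<in> {-1/2..1/2}")
    case True
    then have "R + \<bar>t\<bar> \<le> of_int N" unfolding N_def by (auto simp: abs_le_iff) linarith+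
    from periodization_eq_sum[OF f0 this] show ?thesis by (simp add: sum_distrib_left)
  qed auto
  have ff: "integrable lebesgue (\<lambda>t. ?i (t - of_int j) * f t)" for j
  proof (rule Bochner_Integration.integrable_bound[OF f])
    have "(\<lambda>t :: real. ?i (t - of_int j)) \<in> borel_measurable borel" by measurable
    then show "(\<lambda>t. ?i (t - of_int j) * f t) \<in> borel_measurable lebesgue"
      using f by (intro borel_measurable_times) (auto intro: measurable_completion)
    show "AE t in lebesgue. norm (?i (t - of_int j) * f t) \<le> norm (f t)"
      by (intro AE_I2) (simp add: indicator_def)
  qed
  have shift: "integrable lebesgue (\<lambda>t. ?i t * f (t + of_int j))"
    "(LINT t|lebesgue. ?i t * f (t + of_int j)) = (LINT t|lebesgue. ?i (t - of_int j) * f t)" for j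
    using ff[of j] lebesgue_integrable_real_affine_iff[of 1 "\<lambda>t. ?i (t - of_int j) * f t" "of_int j"]
      lebesgue_integral_real_affine[of 1 "\<lambda>t. ?i (t - of_int j) * f t" "of_int j"]
    by (simp_all add: add.commute)
  show "set_integrable lebesgue {-1/2..1/2} (periodization f)"
    unfolding set_integrable_def real_scaleR_def eq
    by (intro Bochner_Integration.integrable_sum shift(1))
  have "(LINT t:{-1/2..1/2}|lebesgue. periodization f t)
      = (\<Sum>j\<in>{-N..N}. (LINT t|lebesgue. ?i (t - of_int j) * f t))"
    unfolding set_lebesgue_integral_def real_scaleR_def eq
    by (simp only: Bochner_Integration.integral_sum shift)
  also have "\<dots> = (LINT t|lebesgue. (\<Sum>j\<in>{-N..N}. ?i (t - of_int j) * f t))"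
    by (simp only: Bochner_Integration.integral_sum ff)
  also have "\<dots> = (LINT t|lebesgue. f t)"
  proof (rule integral_cong_AE)
    show "(\<lambda>t. \<Sum>j\<in>{-N..N}. ?i (t - of_int j) * f t) \<in> borel_measurable lebesgue"
      by (intro borel_measurable_sum borel_measurable_integrable ff)
    show "f \<in> borel_measurable lebesgue" using f by auto
    show "AE t in lebesgue. (\<Sum>j\<in>{-N..N}. ?i (t - of_int j) * f t) = f t"
      using AE_not_half_integer[of 0]
    proof eventually_elim
      case (elim t)
      show ?case
      proof (cases "\<bar>t\<bar> > R")
        case False
        then have "\<bar>t\<bar> + 1 \<le> of_int N" unfolding N_def by linarith
        then show ?thesis using sum_translates_period[of t N] elim
          by (simp flip: sum_distrib_right)
      qed (simp add: f0)
    qed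
  qed
  finally show "(LINT t:{-1/2..1/2}|lebesgue. periodization f t) = (LINT t|lebesgue. f t)" .
qed

lemma integrable_indicator_Icc: "integrable lebesgue (indicat_real {a..b :: real})"
  by (intro integrable_real_indicator) (auto simp: emeasure_lborel_Icc_eq)

text \<open>The periodization of the indicator of an interval of length 1 is almost everywhere 1, so by
  \<open>integral_periodization\<close> the integral over any interval of that length equals the integral over the
  standard period.\<close>

lemma integral_period_reflect:
  assumes Q: "Q \<in> borel_measurable lebesgue" "periodic1 Q" and le: "\<And>t. \<bar>Q t\<bar> \<le> C"
  shows "(LINT t:{-1/2..1/2}|lebesgue. Q (x - t)) = (LINT t:{-1/2..1/2}|lebesgue. Q t)"
proof -
  let ?i = "indicat_real {-1/2..1/2}"
  let ?f = "\<lambda>s. Q s * ?i (x - s)"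
  have [measurable]: "(\<lambda>s. ?i (x - s)) \<in> borel_measurable lebesgue"
    by (rule measurable_completion) measurable
  have f0: "?f s = 0" if "\<bar>s\<bar> > \<bar>x\<bar> + 1" for s
    using that by (auto simp: indicator_def)
  have C: "0 \<le> C" using le[of 0] by simp
  have int: "integrable lebesgue ?f"
  proof (rule Bochner_Integration.integrable_bound)
    show "integrable lebesgue (\<lambda>s. C * indicat_real {x - 1/2..x + 1/2} s)"
      by (intro integrable_mult_right integrable_indicator_Icc)
    show "?f \<in> borel_measurable lebesgue" using Q(1) by measurable
    show "AE s in lebesgue. norm (?f s) \<le> norm (C * indicat_real {x - 1/2..x + 1/2} s)"
      using le C by (intro AE_I2) (auto simp: indicator_def abs_mult)
  qed
  have one: "AE t in lebesgue. periodization (\<lambda>s. ?i (x - s)) t = 1"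
    using AE_not_half_integer[of x]
  proof eventually_elim
    case (elim t)
    define N where "N = \<lceil>\<bar>x\<bar> + \<bar>t\<bar> + 2\<rceil>"
    have "x - t + 1/2 \<notin> \<int>"
    proof
      assume "x - t + 1/2 \<in> \<int>"
      then have "1 - (x - t + 1/2) \<in> \<int>" by (intro Ints_diff) auto
      then show False using elim by (simp add: algebra_simps)
    qed
    moreover have "\<bar>x - t\<bar> + 1 \<le> of_int N" unfolding N_def by linarith
    ultimately have "(\<Sum>j\<in>{-N..N}. ?i (x - t - of_int j)) = 1"
      by (rule sum_translates_period)
    moreover have "periodization (\<lambda>s. ?i (x - s)) t = (\<Sum>j\<in>{-N..N}. ?i (x - (t + of_int j)))"
    proof (rule periodization_eq_sum)
      show "?i (x - s) = 0" if "\<bar>x\<bar> + 1 < \<bar>s\<bar>" for s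
        using that by (auto simp: indicator_def)
      show "\<bar>x\<bar> + 1 + \<bar>t\<bar> \<le> of_int N" unfolding N_def by linarith
    qed
    ultimately show ?case by (simp add: diff_diff_eq)
  qed
  have "(LINT t:{-1/2..1/2}|lebesgue. Q (x - t)) = (LINT t|lebesgue. ?f (x + (-1) * t))"
    by (simp add: set_lebesgue_integral_def mult.commute)
  also have "\<dots> = (LINT s|lebesgue. ?f s)"
    using lebesgue_integral_real_affine[of "-1" ?f x] by simp
  also have "\<dots> = (LINT t:{-1/2..1/2}|lebesgue. periodization ?f t)"
    using integral_periodization(2)[OF int f0] by simp
  also have "\<dots> = (LINT t:{-1/2..1/2}|lebesgue. Q t)"
    unfolding set_lebesgue_integral_def
  proof (rule integral_cong_AE)
    show "(\<lambda>t. ?i t *\<^sub>R periodization ?f t) \<in> borel_measurable lebesgue"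
      using integral_periodization(1)[OF int f0]
      unfolding set_integrable_def by (rule borel_measurable_integrable)
    show "(\<lambda>t. ?i t *\<^sub>R Q t) \<in> borel_measurable lebesgue"
      by (intro borel_measurable_scaleR borel_measurable_indicator Q(1)) auto
    show "AE t in lebesgue. ?i t *\<^sub>R periodization ?f t = ?i t *\<^sub>R Q t"
      using one by eventually_elim (simp add: periodization_mult_periodic[OF Q(2)])
  qed
  finally show ?thesis .
qed

section \<open>The kernel, the essential supremum and the convolution\<close>

lemma abs_chi_le: "h > 0 \<Longrightarrow> \<bar>chi h t\<bar> \<le> 1 / h"
  by (simp add: chi_def indicator_def)

lemma chi_eq_0: "h > 0 \<Longrightarrow> \<bar>t\<bar> > h / 2 \<Longrightarrow> chi h t = 0"
  by (auto simp: chi_def indicator_def)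

lemma borel_measurable_chi [measurable]: "chi h \<in> borel_measurable borel"
  unfolding chi_def[abs_def] by measurable

lemma borel_measurable_periodization_chi:
  "h > 0 \<Longrightarrow> periodization (chi h) \<in> borel_measurable borel"
  by (rule borel_measurable_periodization[where R="h / 2"]) (simp_all add: chi_eq_0)

lemma periodization_chi_bounded:
  "h > 0 \<Longrightarrow> \<exists>C. \<forall>t. \<bar>periodization (chi h) t\<bar> \<le> C"
  by (rule periodization_bounded[where R="h / 2" and B="1 / h"]) (simp_all add: chi_eq_0 abs_chi_le)

text \<open>Nonempty open sets are not null, so that the essential supremum dominates \<open>\<bar>f x\<bar>\<close> at each point of
  continuity (\<open>sup_norm_ge_isCont\<close>) and is nonnegative.\<close>

lemma AE_lebesgue_open:
  assumes "open U" "U \<noteq> {}" and "AE x in lebesgue. x \<notin> (U :: real set)"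
  shows False
proof -
  have "U \<in> sets lebesgue" using assms(1) by auto
  then have "U \<in> null_sets lebesgue" using assms(3) by (simp add: AE_iff_null_sets)
  then show False using open_not_negligible[OF assms(1,2)] by (simp add: negligible_iff_null_sets)
qed

lemma sup_norm_ge_isCont:
  assumes "isCont f x"
  shows "ereal \<bar>f x\<bar> \<le> sup_norm f"
proof (rule ccontr)
  assume "\<not> ?thesis"
  then have less: "sup_norm f < ereal \<bar>f x\<bar>" by simp
  then obtain c where c: "sup_norm f < ereal c" "c < \<bar>f x\<bar>"
    by (metis ereal_dense2 less_ereal.simps(1))
  have "((\<lambda>y. \<bar>f y\<bar>) \<longlongrightarrow> \<bar>f x\<bar>) (nhds x)"
    using assms by (intro tendsto_rabs) (simp add: isCont_def tendsto_at_iff_tendsto_nhds)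
  then have "\<forall>\<^sub>F y in nhds x. c < \<bar>f y\<bar>"
    using c(2) by (rule order_tendstoD(1))
  then obtain U where U: "open U" "x \<in> U" "\<And>y. y \<in> U \<Longrightarrow> c < \<bar>f y\<bar>"
    by (auto simp: eventually_nhds)
  have "AE y in lebesgue. ereal \<bar>f y\<bar> \<le> sup_norm f"
    unfolding sup_norm_def by (rule esssup_AE)
  then have "AE y in lebesgue. y \<notin> U"
  proof eventually_elim
    case (elim y)
    then have "ereal \<bar>f y\<bar> < ereal c" using c(1) by (rule le_less_trans)
    then show ?case using U(3)[of y] by auto
  qed
  then show False using AE_lebesgue_open[OF U(1)] U(2) by blast
qed

lemma sup_norm_nonneg: "0 \<le> sup_norm f"
proof (rule ccontr)
  assume *: "\<not> 0 \<le> sup_norm f"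
  have "AE y in lebesgue. ereal \<bar>f y\<bar> \<le> sup_norm f"
    unfolding sup_norm_def by (rule esssup_AE)
  then have "AE y in lebesgue. y \<notin> (UNIV :: real set)"
  proof eventually_elim
    case (elim y)
    then have "ereal \<bar>f y\<bar> < 0" using * by (meson le_less_trans not_le)
    then show ?case by simp
  qed
  then show False using AE_lebesgue_open[of UNIV] by blast
qed

lemma Linf_T_sup_norm:
  assumes "g \<in> Linf_T"
  obtains K where "0 \<le> K" "sup_norm g = ereal K" "AE x in lebesgue. \<bar>g x\<bar> \<le> K"
proof -
  have "sup_norm g < \<infinity>" using assms by (simp add: Linf_T_def)
  then obtain K where K: "sup_norm g = ereal K" "0 \<le> K"
    using sup_norm_nonneg[of g] by (cases "sup_norm g") auto
  moreover have "AE x in lebesgue. ereal \<bar>g x\<bar> \<le> sup_norm g"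
    unfolding sup_norm_def by (rule esssup_AE)
  ultimately show thesis using that[of K] by simp
qed

lemma sup_norm_le:
  assumes "f \<in> borel_measurable lebesgue" and "\<And>x. \<bar>f x\<bar> \<le> K"
  shows "sup_norm f \<le> ereal K"
  unfolding sup_norm_def using assms by (intro esssup_I) auto

lemma integrable_mult_chi:
  assumes g: "g \<in> Linf_T" and h: "h > 0"
  shows "integrable lebesgue (\<lambda>t. g t * chi h (x - t))"
proof -
  obtain K where K: "0 \<le> K" "AE x in lebesgue. \<bar>g x\<bar> \<le> K" using Linf_T_sup_norm[OF g] .
  have chi_meas: "(\<lambda>t. chi h (x - t)) \<in> borel_measurable lebesgue"
    by (rule measurable_completion) measurable
  show ?thesis
  proof (rule Bochner_Integration.integrable_bound)
    show "integrable lebesgue (\<lambda>t. K * (1 / h) * indicat_real {x - h/2..x + h/2} t)"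
      by (intro integrable_mult_right integrable_indicator_Icc)
    show "(\<lambda>t. g t * chi h (x - t)) \<in> borel_measurable lebesgue"
      using g chi_meas unfolding Linf_T_def by auto
    show "AE t in lebesgue. norm (g t * chi h (x - t)) \<le> norm (K * (1 / h) * indicat_real {x - h/2..x + h/2} t)"
      using K(2)
    proof eventually_elim
      case (elim t)
      then show ?case using h K(1)
        by (auto simp: chi_def indicator_def abs_mult divide_simps)
    qed
  qed
qed

lemma convol_chi_eq:
  assumes g: "g \<in> Linf_T" and h: "h > 0"
  shows "set_integrable lebesgue {-1/2..1/2} (\<lambda>t. g t * periodization (chi h) (x - t))"
    and "(g \<star> chi h) x = (LINT t:{-1/2..1/2}|lebesgue. g t * periodization (chi h) (x - t))"
proof -
  have "g t * chi h (x - t) = 0" if "\<bar>t\<bar> > \<bar>x\<bar> + h" for t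
    using chi_eq_0[OF h, of "x - t"] that h by (simp add: abs_if split: if_splits)
  note * = integral_periodization[OF integrable_mult_chi[OF g h] this]
  have "periodization (\<lambda>t. g t * chi h (x - t)) = (\<lambda>t. g t * periodization (chi h) (x - t))"
    using g by (simp add: fun_eq_iff Linf_T_def periodization_mult_periodic periodization_reflect)
  then show "set_integrable lebesgue {-1/2..1/2} (\<lambda>t. g t * periodization (chi h) (x - t))"
    "(g \<star> chi h) x = (LINT t:{-1/2..1/2}|lebesgue. g t * periodization (chi h) (x - t))"
    using * by (simp_all add: convol_def)
qed

lemma abs_diff_indicator_le: "\<bar>indicat_real A u - indicat_real B v\<bar> \<le> 1"
  by (simp add: indicator_def)

lemma translates_agree_off_endpoints:
  fixes x y t d h :: real
  assumes yd: "x - d \<le> y" "y \<le> x + d"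
    and t: "\<not> (t \<in> {x - h/2 - d..x - h/2 + d} \<or> t \<in> {x + h/2 - d..x + h/2 + d})"
  shows "y - t \<in> {-h/2<..<h/2} \<longleftrightarrow> x - t \<in> {-h/2<..<h/2}"
proof -
  have *: "t < x - h/2 - d \<or> x - h/2 + d < t" "t < x + h/2 - d \<or> x + h/2 + d < t"
    using t by auto
  define k where "k = h/2"
  have "-k < y - t \<and> y - t < k \<longleftrightarrow> -k < x - t \<and> x - t < k"
    using * yd unfolding k_def[symmetric] by linarith
  then show ?thesis by (simp add: k_def)
qed

text \<open>Translating an interval by at most \<open>d\<close> changes its indicator only within distance \<open>d\<close> of its
  endpoints.\<close>

lemma abs_diff_shifted_indicator_le:
  fixes x y t d h :: real
  assumes "\<bar>y - x\<bar> \<le> d"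
  shows "\<bar>indicat_real {-h/2<..<h/2} (y - t) - indicat_real {-h/2<..<h/2} (x - t)\<bar>
    \<le> indicat_real {x - h/2 - d..x - h/2 + d} t + indicat_real {x + h/2 - d..x + h/2 + d} t"
proof (cases "t \<in> {x - h/2 - d..x - h/2 + d} \<or> t \<in> {x + h/2 - d..x + h/2 + d}")
  case True
  have "\<bar>indicat_real {-h/2<..<h/2} (y - t) - indicat_real {-h/2<..<h/2} (x - t)\<bar> \<le> 1"
    by (rule abs_diff_indicator_le)
  also have "1 \<le> indicat_real {x - h/2 - d..x - h/2 + d} t + indicat_real {x + h/2 - d..x + h/2 + d} t"
    using True
  proof
    assume "t \<in> {x - h/2 - d..x - h/2 + d}"
    then have "indicat_real {x - h/2 - d..x - h/2 + d} t = 1" by (rule indicator_simps(1))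
    then show ?thesis by (simp only: le_add_same_cancel1 indicator_pos_le)
  next
    assume "t \<in> {x + h/2 - d..x + h/2 + d}"
    then have "indicat_real {x + h/2 - d..x + h/2 + d} t = 1" by (rule indicator_simps(1))
    then show ?thesis by (simp only: le_add_same_cancel2 indicator_pos_le)
  qed
  finally show ?thesis .
next
  case False
  have "x - d \<le> y" "y \<le> x + d" using assms by linarith+
  then have "y - t \<in> {-h/2<..<h/2} \<longleftrightarrow> x - t \<in> {-h/2<..<h/2}"
    using False by (rule translates_agree_off_endpoints)
  then have "indicat_real {-h/2<..<h/2} (y - t) = indicat_real {-h/2<..<h/2} (x - t)"
    unfolding indicator_def by (simp only:)
  then show ?thesis by (simp only: diff_self abs_zero add_nonneg_nonneg indicator_pos_le)
qed

text \<open>The convolution is Lipschitz. Continuity turns its value at one point into a lower bound for its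
  essential supremum and supplies the measurability on which upper bounds for that supremum depend.\<close>

lemma isCont_convol_chi:
  assumes g: "g \<in> Linf_T" and h: "h > 0"
  shows "isCont (g \<star> chi h) x"
proof -
  obtain K where K: "0 \<le> K" "AE x in lebesgue. \<bar>g x\<bar> \<le> K" using Linf_T_sup_norm[OF g] .
  define c where "c = K / h"
  have lip: "\<bar>(g \<star> chi h) y - (g \<star> chi h) x\<bar> \<le> 4 * c * \<bar>y - x\<bar>" for y
  proof -
    define d where "d = \<bar>y - x\<bar>"
    let ?b = "\<lambda>t. c * (indicat_real {x - h/2 - d..x - h/2 + d} t + indicat_real {x + h/2 - d..x + h/2 + d} t)"
    have int_b: "integrable lebesgue ?b"
      by (intro integrable_mult_right Bochner_Integration.integrable_add integrable_indicator_Icc)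
    have "(g \<star> chi h) y - (g \<star> chi h) x = (LINT t|lebesgue. g t * chi h (y - t) - g t * chi h (x - t))"
      unfolding convol_def
      by (intro Bochner_Integration.integral_diff[symmetric] integrable_mult_chi g h)
    then have "\<bar>(g \<star> chi h) y - (g \<star> chi h) x\<bar>
        \<le> (LINT t|lebesgue. \<bar>g t * chi h (y - t) - g t * chi h (x - t)\<bar>)"
      by (simp only: integral_abs_bound)
    also have "\<dots> \<le> (LINT t|lebesgue. ?b t)"
    proof (rule integral_mono_AE[OF _ int_b])
      show "integrable lebesgue (\<lambda>t. \<bar>g t * chi h (y - t) - g t * chi h (x - t)\<bar>)"
        by (intro integrable_abs Bochner_Integration.integrable_diff integrable_mult_chi g h)
      show "AE t in lebesgue. \<bar>g t * chi h (y - t) - g t * chi h (x - t)\<bar> \<le> ?b t"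
        using K(2)
      proof eventually_elim
        case (elim t)
        define \<Delta> where "\<Delta> = indicat_real {-h/2<..<h/2} (y - t) - indicat_real {-h/2<..<h/2} (x - t)"
        have \<Delta>_le: "\<bar>\<Delta>\<bar>
            \<le> indicat_real {x - h/2 - d..x - h/2 + d} t + indicat_real {x + h/2 - d..x + h/2 + d} t"
          unfolding \<Delta>_def by (rule abs_diff_shifted_indicator_le) (simp add: d_def)
        have "g t * chi h (y - t) - g t * chi h (x - t) = g t / h * \<Delta>"
          by (simp add: chi_def \<Delta>_def right_diff_distrib)
        then have "\<bar>g t * chi h (y - t) - g t * chi h (x - t)\<bar> = \<bar>g t\<bar> / h * \<bar>\<Delta>\<bar>"
          using h by (simp only: abs_mult abs_divide abs_of_pos)
        also have "\<dots> \<le> ?b t"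
        proof (rule mult_mono[OF _ \<Delta>_le])
          show "\<bar>g t\<bar> / h \<le> c" using elim h unfolding c_def by (intro divide_right_mono) simp_all
          show "0 \<le> c" using K(1) h unfolding c_def by simp
        qed simp
        finally show ?case .
      qed
    qed
    also have "\<dots> = c * (2 * d + 2 * d)"
      by (simp add: d_def)
    also have "\<dots> = 4 * c * \<bar>y - x\<bar>" by (simp add: d_def)
    finally show ?thesis .
  qed
  have "((\<lambda>y. (g \<star> chi h) y - (g \<star> chi h) x) \<longlongrightarrow> 0) (at x)"
  proof (rule Lim_null_comparison)
    show "\<forall>\<^sub>F y in at x. norm ((g \<star> chi h) y - (g \<star> chi h) x) \<le> 4 * c * \<bar>y - x\<bar>"
      using lip by (intro always_eventually) simp
    have "((\<lambda>y. 4 * c * \<bar>y - x\<bar>) \<longlongrightarrow> 4 * c * \<bar>x - x\<bar>) (at x)"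
      by (intro tendsto_intros)
    then show "((\<lambda>y. 4 * c * \<bar>y - x\<bar>) \<longlongrightarrow> 0) (at x)" by simp
  qed
  then show ?thesis unfolding isCont_def by (rule LIM_zero_cancel)
qed

section \<open>Duality on the circle\<close>

text \<open>As a density on the whole line, and not a restriction to the period, this measure has the same
  measurable functions as Lebesgue measure, so that the function given by the duality lemma is
  measurable on the whole line.\<close>

definition period_measure :: "real measure" where
  "period_measure = density lebesgue (\<lambda>x. ennreal (indicat_real {-1/2..1/2} x))"

lemma borel_measurable_indicator_Icc [simp]:
  fixes a b :: real
  shows "indicat_real {a..b} \<in> borel_measurable lebesgue"
    and "(\<lambda>x. ennreal (indicat_real {a..b} x)) \<in> borel_measurable lebesgue"
proof -
  show *: "indicat_real {a..b} \<in> borel_measurable lebesgue"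
    by (rule borel_measurable_indicator) simp
  show "(\<lambda>x. ennreal (indicat_real {a..b} x)) \<in> borel_measurable lebesgue"
    using * by (rule measurable_compose) (rule measurable_ennreal)
qed

lemma finite_measure_period: "finite_measure period_measure"
proof
  have "emeasure period_measure (space period_measure)
      = (\<integral>\<^sup>+x. ennreal (indicat_real {-1/2..1/2} x) \<partial>(lebesgue :: real measure))"
    unfolding period_measure_def by (subst emeasure_density) (simp_all del: ennreal_indicator)
  also have "\<dots> = emeasure lebesgue {-1/2..1/2 :: real}"
    unfolding ennreal_indicator by (rule nn_integral_indicator) simp
  finally show "emeasure period_measure (space period_measure) \<noteq> \<infinity>"
    by (simp add: emeasure_lborel_Icc_eq)
qed

lemma borel_measurable_period: "borel_measurable period_measure = (borel_measurable lebesgue :: (real \<Rightarrow> real) set)"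
  by (intro measurable_cong_sets) (auto simp: period_measure_def)

lemma integral_period:
  fixes f :: "real \<Rightarrow> real"
  assumes "f \<in> borel_measurable lebesgue"
  shows "(LINT x|period_measure. f x) = (LINT x:{-1/2..1/2}|lebesgue. f x)"
  unfolding set_lebesgue_integral_def period_measure_def using assms
  by (intro integral_density) (auto simp del: ennreal_indicator)

lemma integrable_period:
  fixes f :: "real \<Rightarrow> real"
  assumes "f \<in> borel_measurable lebesgue"
  shows "integrable period_measure f \<longleftrightarrow> set_integrable lebesgue {-1/2..1/2} f"
  unfolding set_integrable_def period_measure_def using assms
  by (intro integrable_density) (auto simp del: ennreal_indicator)

lemma set_integrable_period_bounded:
  fixes f :: "real \<Rightarrow> real"
  assumes "f \<in> borel_measurable lebesgue" "AE x in lebesgue. \<bar>f x\<bar> \<le> B"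
  shows "set_integrable lebesgue {-1/2..1/2} f"
proof -
  interpret finite_measure period_measure by (rule finite_measure_period)
  have "integrable period_measure f"
  proof (rule integrable_const_bound)
    show "AE x in period_measure. norm (f x) \<le> B"
      using assms(2) unfolding period_measure_def
      by (subst AE_density) (auto elim: eventually_mono simp del: ennreal_indicator)
  qed (use assms(1) in \<open>simp add: borel_measurable_period\<close>)
  then show ?thesis using assms(1) by (simp add: integrable_period)
qed

lemma borel_measurable_trig_basis: "trig_basis k \<in> borel_measurable lebesgue"
  by (intro measurable_completion) (simp add: borel_measurable_continuous_onI continuous_trig_basis)

lemma borel_measurable_trig_polys: "\<tau> \<in> trig_polys n \<Longrightarrow> \<tau> \<in> borel_measurable lebesgue"
  by (intro measurable_completion) (simp add: borel_measurable_continuous_onI continuous_trig_polys)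

lemma trig_perp_iff:
  assumes "g \<in> Linf_T"
  shows "g \<in> trig_perp n \<longleftrightarrow>
    (\<forall>k\<in>trig_index n. (LINT t:{-1/2..1/2}|lebesgue. g t * trig_basis k t) = 0)" (is "_ \<longleftrightarrow> ?R")
proof
  assume g: "g \<in> trig_perp n"
  show ?R
  proof
    fix k assume k: "k \<in> trig_index n"
    have "trig_basis k = (\<lambda>x. \<Sum>l\<in>trig_index n. (if l = k then 1 else 0) * trig_basis l x)"
    proof
      fix x
      have "(\<Sum>l\<in>trig_index n. (if l = k then 1 else 0) * trig_basis l x)
          = (\<Sum>l\<in>trig_index n. if l = k then trig_basis l x else 0)"
        by (intro sum.cong) auto
      then show "trig_basis k x = (\<Sum>l\<in>trig_index n. (if l = k then 1 else 0) * trig_basis l x)"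
        using k by simp
    qed
    then have "trig_basis k \<in> trig_polys n"
      unfolding trig_polys_eq by (rule range_eqI[where x="\<lambda>l. if l = k then 1 else 0"])
    then show "(LINT t:{-1/2..1/2}|lebesgue. g t * trig_basis k t) = 0"
      using g by (simp add: trig_perp_def)
  qed
next
  assume R: ?R
  obtain K where K: "0 \<le> K" "AE x in lebesgue. \<bar>g x\<bar> \<le> K" using Linf_T_sup_norm[OF assms] .
  have gm: "g \<in> borel_measurable lebesgue" using assms by (simp add: Linf_T_def)
  have int: "set_integrable lebesgue {-1/2..1/2} (\<lambda>t. g t * trig_basis k t)" for k
  proof (rule set_integrable_period_bounded)
    show "(\<lambda>t. g t * trig_basis k t) \<in> borel_measurable lebesgue"
      using gm borel_measurable_trig_basis by (rule borel_measurable_times)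
    show "AE t in lebesgue. \<bar>g t * trig_basis k t\<bar> \<le> K"
      using K(2)
    proof eventually_elim
      case (elim t)
      then show ?case using mult_mono[OF elim abs_trig_basis_le[of k t]] K(1) by (simp add: abs_mult)
    qed
  qed
  have "(LINT t:{-1/2..1/2}|lebesgue. g t * \<tau> t) = 0" if \<tau>_in: "\<tau> \<in> trig_polys n" for \<tau>
  proof -
    obtain a where \<tau>: "\<tau> = (\<lambda>x. \<Sum>k\<in>trig_index n. a k * trig_basis k x)"
      using \<tau>_in by (auto simp: trig_polys_eq)
    have "indicat_real {-1/2..1/2} t *\<^sub>R (g t * \<tau> t)
        = (\<Sum>k\<in>trig_index n. a k * (indicat_real {-1/2..1/2} t *\<^sub>R (g t * trig_basis k t)))" for t
      unfolding \<tau> sum_distrib_left scaleR_sum_right by (intro sum.cong) auto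
    then have "(LINT t:{-1/2..1/2}|lebesgue. g t * \<tau> t)
        = (\<Sum>k\<in>trig_index n. a k * (LINT t:{-1/2..1/2}|lebesgue. g t * trig_basis k t))"
      using int unfolding set_lebesgue_integral_def set_integrable_def
      by (simp only: Bochner_Integration.integral_sum integrable_mult_right integral_mult_right_zero)
    also have "\<dots> = 0" using R by simp
    finally show ?thesis .
  qed
  then show "g \<in> trig_perp n" using assms by (simp add: trig_perp_def)
qed

lemma bdd_below_best_approx:
  "bdd_below ((\<lambda>\<tau>. LINT t:{-1/2..1/2}|lebesgue. \<bar>F t - \<tau> t :: real\<bar>) ` S)"
  by (rule bdd_belowI[of _ 0]) (auto simp: set_lebesgue_integral_def intro!: Bochner_Integration.integral_nonneg)

lemma trig_polys_nonempty: "trig_polys n \<noteq> {}"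
  by (simp add: trig_polys_eq)

lemma best_approx_L1_nonneg: "0 \<le> best_approx_L1 n F"
  unfolding best_approx_L1_def
  by (rule cINF_greatest[OF trig_polys_nonempty])
    (auto simp: set_lebesgue_integral_def intro!: Bochner_Integration.integral_nonneg)

lemma circle_L1_duality:
  assumes F: "F \<in> borel_measurable lebesgue" "periodic1 F" "set_integrable lebesgue {-1/2..1/2} F"
    and \<epsilon>: "\<epsilon> > 0"
  obtains g where "g \<in> trig_perp n" "\<And>x. \<bar>g x\<bar> \<le> 1"
    "best_approx_L1 n F - \<epsilon> \<le> (LINT t:{-1/2..1/2}|lebesgue. g t * F t)"
proof -
  interpret finite_measure period_measure by (rule finite_measure_period)
  have basis_mult: "(LINT x|period_measure. trig_basis k x * trig_basis l x)
      = (LINT x:{-1/2..1/2}|lebesgue. trig_basis k x * trig_basis l x)" for k l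
    by (intro integral_period borel_measurable_times borel_measurable_trig_basis)
  have idx: "k \<noteq> Inr 0" if "k \<in> trig_index n" for k using that by (auto simp: trig_index_def)
  have E: "best_approx_L1 n F \<le> (LINT x|period_measure. \<bar>F x - (\<Sum>k\<in>trig_index n. a k * trig_basis k x)\<bar>)" for a
  proof -
    have \<tau>: "(\<lambda>x. \<Sum>k\<in>trig_index n. a k * trig_basis k x) \<in> trig_polys n"
      by (auto simp: trig_polys_eq)
    have "(\<lambda>x. \<bar>F x - (\<Sum>k\<in>trig_index n. a k * trig_basis k x)\<bar>) \<in> borel_measurable lebesgue"
      using F(1) borel_measurable_trig_polys[OF \<tau>] by measurable
    then have "(LINT x|period_measure. \<bar>F x - (\<Sum>k\<in>trig_index n. a k * trig_basis k x)\<bar>)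
        = (LINT x:{-1/2..1/2}|lebesgue. \<bar>F x - (\<Sum>k\<in>trig_index n. a k * trig_basis k x)\<bar>)"
      by (rule integral_period)
    then show ?thesis
      unfolding best_approx_L1_def using cINF_lower[OF bdd_below_best_approx \<tau>, of F] by simp
  qed
  have basis_meas: "trig_basis i \<in> borel_measurable period_measure" for i
    by (simp only: borel_measurable_period borel_measurable_trig_basis)
  have orth: "(LINT x|period_measure. trig_basis i x * trig_basis k x) = 0"
    if "i \<in> trig_index n" "k \<in> trig_index n" "i \<noteq> k" for i k
    unfolding basis_mult integral_trig_basis_mult[OF idx[OF that(1)] idx[OF that(2)]]
    using that(3) by simp
  have norm: "0 < (LINT x|period_measure. trig_basis i x * trig_basis i x)"
    if "i \<in> trig_index n" for i
    unfolding basis_mult integral_trig_basis_mult[OF idx[OF that] idx[OF that]] by simp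
  have int: "integrable period_measure F" using F by (simp add: integrable_period)
  obtain g where g: "g \<in> borel_measurable period_measure" "\<And>x. \<bar>g x\<bar> \<le> 1"
    "\<And>i. i \<in> trig_index n \<Longrightarrow> (LINT x|period_measure. g x * trig_basis i x) = 0"
    "\<And>x y. F x = F y \<Longrightarrow> (\<And>i. i \<in> trig_index n \<Longrightarrow> trig_basis i x = trig_basis i y) \<Longrightarrow> g x = g y"
    "best_approx_L1 n F - \<epsilon> \<le> (LINT x|period_measure. g x * F x)"
    using L1_duality[OF finite_trig_index basis_meas abs_trig_basis_le orth norm int \<epsilon>
        best_approx_L1_nonneg E] by blast
  have gm: "g \<in> borel_measurable lebesgue" using g(1) by (simp only: borel_measurable_period)
  have "sup_norm g \<le> ereal 1" by (rule sup_norm_le[OF gm g(2)])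
  moreover have "periodic1 g"
    unfolding periodic1_def using F(2) by (intro allI g(4)) (auto simp: periodic1_def trig_basis_periodic)
  ultimately have gL: "g \<in> Linf_T" using gm by (auto simp: Linf_T_def)
  show thesis
  proof
    show "g \<in> trig_perp n"
      unfolding trig_perp_iff[OF gL]
      using g(3) gm by (simp add: integral_period borel_measurable_times borel_measurable_trig_basis)
    show "best_approx_L1 n F - \<epsilon> \<le> (LINT t:{-1/2..1/2}|lebesgue. g t * F t)"
      using g(5) gm F(1) by (simp add: integral_period borel_measurable_times)
  qed (rule g(2))
qed

section \<open>The two bounds\<close>

text \<open>As \<open>g\<close> annihilates the reflected polynomial \<open>t \<mapsto> \<tau> (x - t)\<close>, the kernel may be replaced by its
  difference from that polynomial. The bound is then independent of \<open>x\<close>, because reflection and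
  translation do not change integrals over a period.\<close>

lemma convol_chi_le:
  assumes g: "g \<in> trig_perp n" and K: "sup_norm g = ereal K" and h: "h > 0" and \<tau>: "\<tau> \<in> trig_polys n"
  shows "\<bar>(g \<star> chi h) x\<bar> \<le> K * (LINT t:{-1/2..1/2}|lebesgue. \<bar>periodization (chi h) t - \<tau> t\<bar>)"
proof -
  let ?P = "periodization (chi h)"
  let ?T = "{-1/2..1/2} :: real set"
  have gL: "g \<in> Linf_T" using g by (simp add: trig_perp_def)
  have gm: "g \<in> borel_measurable lebesgue" using gL by (simp add: Linf_T_def)
  have AE: "AE x in lebesgue. \<bar>g x\<bar> \<le> K" and K0: "0 \<le> K"
    using Linf_T_sup_norm[OF gL] K by auto
  have Pb: "?P \<in> borel_measurable borel" by (rule borel_measurable_periodization_chi[OF h])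
  have \<tau>b: "\<tau> \<in> borel_measurable borel" using \<tau> by (simp add: borel_measurable_continuous_onI continuous_trig_polys)
  obtain C1 where C1: "\<bar>?P t\<bar> \<le> C1" for t using periodization_chi_bounded[OF h] by auto
  obtain C2 where C2: "\<bar>\<tau> t\<bar> \<le> C2" for t using trig_polys_bounded[OF \<tau>] by auto
  have \<tau>': "(\<lambda>t. \<tau> (x - t)) \<in> trig_polys n" by (rule trig_polys_reflect[OF \<tau>])
  define D where "D t = \<bar>?P t - \<tau> t\<bar>" for t
  have Db: "D \<in> borel_measurable borel" unfolding D_def[abs_def] using Pb \<tau>b by measurable
  have Dm: "(\<lambda>t. D (x - t)) \<in> borel_measurable lebesgue"
    by (rule measurable_completion) (use Db in measurable)
  have D_le: "\<bar>D t\<bar> \<le> C1 + C2" for t using C1[of t] C2[of t] by (simp add: D_def)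
  have int_D: "set_integrable lebesgue ?T (\<lambda>t. D (x - t))"
    using D_le by (intro set_integrable_period_bounded[OF Dm, of "C1 + C2"]) auto
  have int_g\<tau>: "set_integrable lebesgue ?T (\<lambda>t. g t * \<tau> (x - t))"
  proof (rule set_integrable_period_bounded)
    show "(\<lambda>t. g t * \<tau> (x - t)) \<in> borel_measurable lebesgue"
      by (rule borel_measurable_times[OF gm borel_measurable_trig_polys[OF \<tau>']])
    show "AE t in lebesgue. \<bar>g t * \<tau> (x - t)\<bar> \<le> K * C2"
      using AE by eventually_elim (use C2 K0 in \<open>auto simp: abs_mult intro!: mult_mono\<close>)
  qed
  have int_diff: "set_integrable lebesgue ?T (\<lambda>t. g t * ?P (x - t) - g t * \<tau> (x - t))"
    by (rule set_integral_diff(1)[OF convol_chi_eq(1)[OF gL h] int_g\<tau>])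
  have "(g \<star> chi h) x = (LINT t:?T|lebesgue. g t * ?P (x - t)) - (LINT t:?T|lebesgue. g t * \<tau> (x - t))"
    using g \<tau>' convol_chi_eq(2)[OF gL h] by (simp add: trig_perp_def)
  also have "\<dots> = (LINT t:?T|lebesgue. g t * ?P (x - t) - g t * \<tau> (x - t))"
    by (rule set_integral_diff(2)[symmetric, OF convol_chi_eq(1)[OF gL h] int_g\<tau>])
  finally have "\<bar>(g \<star> chi h) x\<bar> \<le> (LINT t:?T|lebesgue. \<bar>g t * ?P (x - t) - g t * \<tau> (x - t)\<bar>)"
    using set_integral_norm_bound[OF int_diff] by simp
  also have "\<dots> \<le> (LINT t:?T|lebesgue. K * D (x - t))"
  proof (rule set_integral_mono_AE)
    show "set_integrable lebesgue ?T (\<lambda>t. \<bar>g t * ?P (x - t) - g t * \<tau> (x - t)\<bar>)"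
      using set_integrable_abs[OF int_diff] .
    show "set_integrable lebesgue ?T (\<lambda>t. K * D (x - t))" using int_D by simp
    show "AE t\<in>?T in lebesgue. \<bar>g t * ?P (x - t) - g t * \<tau> (x - t)\<bar> \<le> K * D (x - t)"
      using AE
    proof eventually_elim
      case (elim t)
      have "\<bar>g t * ?P (x - t) - g t * \<tau> (x - t)\<bar> = \<bar>g t\<bar> * D (x - t)"
        by (simp add: D_def flip: abs_mult right_diff_distrib)
      then show ?case using elim by (simp add: D_def mult_right_mono)
    qed
  qed
  also have "\<dots> = K * (LINT t:?T|lebesgue. D (x - t))" by simp
  also have "(LINT t:?T|lebesgue. D (x - t)) = (LINT t:?T|lebesgue. D t)"
  proof (rule integral_period_reflect[OF _ _ D_le])
    show "D \<in> borel_measurable lebesgue" by (rule measurable_completion) (use Db in measurable)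
    show "periodic1 D" using periodic1_periodization[of "chi h"] trig_polys_periodic[OF \<tau>]
      by (simp add: D_def periodic1_def)
  qed
  finally show ?thesis by (simp add: D_def)
qed

lemma sup_norm_pos:
  assumes g: "g \<in> Linf_T" and nz: "\<not> (AE x in lebesgue. g x = 0)"
  obtains K where "0 < K" "sup_norm g = ereal K"
proof -
  obtain K where K: "0 \<le> K" "sup_norm g = ereal K" "AE x in lebesgue. \<bar>g x\<bar> \<le> K"
    using Linf_T_sup_norm[OF g] .
  have "K \<noteq> 0" using K(3) nz by auto
  with K that show thesis by auto
qed

lemma best_const_le:
  assumes h: "h > 0"
  shows "best_const h n \<le> ereal (best_approx_L1 n (periodization (chi h)))" (is "_ \<le> ereal ?E")
  unfolding best_const_def
proof (rule SUP_least)
  fix g assume "g \<in> {g \<in> trig_perp n. \<not> (AE x in lebesgue. g x = 0)}"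
  then have g: "g \<in> trig_perp n" "g \<in> Linf_T" "\<not> (AE x in lebesgue. g x = 0)"
    by (auto simp: trig_perp_def)
  obtain K where K: "0 < K" "sup_norm g = ereal K" using sup_norm_pos[OF g(2,3)] .
  have "\<bar>(g \<star> chi h) x\<bar> / K \<le> ?E" for x
    unfolding best_approx_L1_def
    using convol_chi_le[OF g(1) K(2) h] K(1)
    by (intro cINF_greatest[OF trig_polys_nonempty]) (simp add: pos_divide_le_eq mult.commute)
  then have le: "\<bar>(g \<star> chi h) x\<bar> \<le> K * ?E" for x
    using K(1) by (simp add: pos_divide_le_eq mult.commute)
  have "g \<star> chi h \<in> borel_measurable borel"
    using isCont_convol_chi[OF g(2) h]
    by (intro borel_measurable_continuous_onI continuous_at_imp_continuous_on) auto
  then have "sup_norm (g \<star> chi h) \<le> ereal (K * ?E)"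
    by (intro sup_norm_le le measurable_completion) auto
  then have "sup_norm (g \<star> chi h) / ereal K \<le> ereal (K * ?E) / ereal K"
    using K(1) by (intro ereal_divide_right_mono) auto
  also have "\<dots> = ereal ?E" using K(1) by simp
  finally show "sup_norm (g \<star> chi h) / sup_norm g \<le> ereal ?E" using K(2) by simp
qed

text \<open>The cosine of frequency \<open>n\<close> shows that the supremum defining the best constant is not over the
  empty set; over the empty set it would be \<open>-\<infinity>\<close>.\<close>

lemma cos_in_trig_perp: "trig_basis (Inl n) \<in> trig_perp n"
proof -
  have "sup_norm (trig_basis (Inl n)) \<le> ereal 1"
    by (rule sup_norm_le[OF borel_measurable_trig_basis abs_trig_basis_le])
  then have gL: "trig_basis (Inl n) \<in> Linf_T"
    using borel_measurable_trig_basis[of "Inl n"]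
    by (auto simp: Linf_T_def periodic1_def trig_basis_periodic simp del: trig_basis.simps)
  show ?thesis
    unfolding trig_perp_iff[OF gL]
  proof
    fix k assume "k \<in> trig_index n"
    then have k: "k \<noteq> Inr 0" "Inl n \<noteq> k" by (auto simp: trig_index_def)
    show "(LINT t:{-1/2..1/2}|lebesgue. trig_basis (Inl n) t * trig_basis k t) = 0"
      using integral_trig_basis_mult[of "Inl n" k] k by (simp only: sum.distinct if_True not_False_eq_True)
  qed
qed

lemma set_integral_mult_AE_zero:
  assumes "AE x in lebesgue. g x = (0 :: real)"
  shows "(LINT t:{-1/2..1/2}|lebesgue. g t * f t) = 0"
  unfolding set_lebesgue_integral_def
  by (rule integral_eq_zero_AE) (use assms in \<open>auto elim: eventually_mono\<close>)

lemma best_const_nonneg: "0 \<le> best_const h n"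
proof -
  let ?g = "trig_basis (Inl n)"
  have nz: "\<not> (AE x in lebesgue. ?g x = 0)"
  proof
    assume "AE x in lebesgue. ?g x = 0"
    then have "(LINT x:{-1/2..1/2}|lebesgue. ?g x * ?g x) = 0" by (rule set_integral_mult_AE_zero)
    moreover have "(LINT x:{-1/2..1/2}|lebesgue. ?g x * ?g x) = (if Inl n = (Inl 0 :: nat + nat) then 1 else 1/2)"
      using integral_trig_basis_mult[of "Inl n" "Inl n"] by (simp only: sum.distinct if_False not_False_eq_True simp_thms)
    ultimately show False by (simp only:) (simp split: if_splits)
  qed
  have gL: "?g \<in> Linf_T" using cos_in_trig_perp by (simp add: trig_perp_def)
  obtain K where K: "0 < K" "sup_norm ?g = ereal K" using sup_norm_pos[OF gL nz] .
  have "0 \<le> sup_norm (?g \<star> chi h) / sup_norm ?g"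
    using K sup_norm_nonneg by (simp add: zero_le_divide_ereal)
  also have "\<dots> \<le> best_const h n"
    unfolding best_const_def using cos_in_trig_perp nz by (intro SUP_upper CollectI conjI)
  finally show ?thesis .
qed

lemma periodization_chi_even: "periodization (chi h) (- t) = periodization (chi h) t"
proof -
  have "chi h (0 - s) = chi h s" for s by (auto simp: chi_def indicator_def)
  then show ?thesis using periodization_reflect[of "chi h" 0 t] by simp
qed

text \<open>The nearly extremal function of \<open>circle_L1_duality\<close> is nearly extremal for the convolution
  inequality as well: as the kernel is even, the duality integral is the value of the convolution at 0.\<close>

lemma best_const_ge:
  assumes h: "h > 0" and \<epsilon>: "\<epsilon> > 0"
  shows "ereal (best_approx_L1 n (periodization (chi h)) - \<epsilon>) \<le> best_const h n" (is "ereal (?E - \<epsilon>) \<le> _")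
proof (cases "?E - \<epsilon> > 0")
  case False
  then have "ereal (?E - \<epsilon>) \<le> 0" by simp
  then show ?thesis using best_const_nonneg order_trans by blast
next
  case True
  let ?P = "periodization (chi h)"
  obtain C where C: "\<bar>?P t\<bar> \<le> C" for t using periodization_chi_bounded[OF h] by auto
  have "?P \<in> borel_measurable borel" by (rule borel_measurable_periodization_chi[OF h])
  then have Pm: "?P \<in> borel_measurable lebesgue" by (intro measurable_completion) simp
  have int: "set_integrable lebesgue {-1/2..1/2} ?P"
    using C by (intro set_integrable_period_bounded[OF Pm]) auto
  obtain g where g: "g \<in> trig_perp n" "\<And>x. \<bar>g x\<bar> \<le> 1"
    "?E - \<epsilon> \<le> (LINT t:{-1/2..1/2}|lebesgue. g t * ?P t)"
    using circle_L1_duality[OF Pm periodic1_periodization int \<epsilon>] by blast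
  have gL: "g \<in> Linf_T" using g(1) by (simp add: trig_perp_def)
  have nz: "\<not> (AE x in lebesgue. g x = 0)"
    using set_integral_mult_AE_zero[of g ?P] g(3) True by auto
  obtain K where K: "0 < K" "sup_norm g = ereal K" using sup_norm_pos[OF gL nz] .
  have "sup_norm g \<le> ereal 1" using gL g(2) by (intro sup_norm_le) (auto simp: Linf_T_def)
  then have K1: "K \<le> 1" using K(2) by simp
  have "?E - \<epsilon> \<le> (g \<star> chi h) 0"
    using g(3) convol_chi_eq(2)[OF gL h, of 0] by (simp add: periodization_chi_even)
  then have "?E - \<epsilon> \<le> \<bar>(g \<star> chi h) 0\<bar>" by simp
  then have ge: "ereal (?E - \<epsilon>) \<le> sup_norm (g \<star> chi h)"
    using sup_norm_ge_isCont[OF isCont_convol_chi[OF gL h]] by (meson ereal_less_eq(3) order_trans)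
  \<comment> \<open>The norm of \<open>g\<close> may be less than 1; dividing by it only increases the quotient.\<close>
  have "(?E - \<epsilon>) * K \<le> ?E - \<epsilon>" using True K K1 by (intro mult_left_le) auto
  then have "ereal (?E - \<epsilon>) \<le> ereal (?E - \<epsilon>) / ereal K"
    using K(1) by (simp add: pos_le_divide_eq)
  also have "\<dots> \<le> sup_norm (g \<star> chi h) / sup_norm g"
    unfolding K(2) using K(1) ge by (intro ereal_divide_right_mono) auto
  also have "\<dots> \<le> best_const h n"
    unfolding best_const_def using g(1) nz by (intro SUP_upper) simp
  finally show ?thesis .
qed

theorem mainTheorem1:
  fixes n :: nat and h :: real
  assumes "n \<ge> 1" and "h > 0"
  shows "best_const h n = ereal (best_approx_L1 n (periodization (chi h)))"
proof (rule antisym)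
  show "best_const h n \<le> ereal (best_approx_L1 n (periodization (chi h)))"
    by (rule best_const_le[OF assms(2)])
  show "ereal (best_approx_L1 n (periodization (chi h))) \<le> best_const h n"
  proof (rule ereal_le_epsilon2)
    fix \<epsilon> :: real assume "\<epsilon> > 0"
    then show "ereal (best_approx_L1 n (periodization (chi h))) \<le> best_const h n + ereal \<epsilon>"
      using best_const_ge[OF assms(2), of \<epsilon> n]
      by (cases "best_const h n") auto
  qed
qed

end
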